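(* Let $p$ be a prime number. Then $s_p(X(\mathbb{F}_2^4))=11$ if $p\neq 3$, and $s_3(X(\mathbb{F}_2^4))=10$.
   Context: For a prime $p$ and an integer $n\ge 0$, the universal simplicial complex $X(\mathbb{F}_p^n)$ is the abstract simplicial complex whose vertices are the nonzero vectors of $\mathbb{F}_p^n$ and whose simplices are the sets of vectors that are linearly independent over $\mathbb{F}_p$. A simplicial map is nondegenerate if it is injective on the vertex set of every simplex (equivalently, it maps every $j$-simplex onto a $j$-simplex). For a finite simplicial complex $\mathcal{K}$ with $m$ vertices, the mod $p$ Buchstaber invariant of $\mathcal{K}$ is the integer $s_p(\mathcal{K})=m-r$, where $r$ is the least integer such that there is a nondegenerate simplicial map $\mathcal{K}\to X(\mathbb{F}_p^r)$. *)

theory Defs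
  imports "HOL-Number_Theory.Residues" "Jordan_Normal_Form.Missing_VectorSpace"
begin

text \<open>An abstract simplicial complex is given by its set of simplices, the empty simplex included;
  its vertices are the points that lie in some simplex.\<close>

definition simplicial_complex :: "'a set set \<Rightarrow> bool" where
  "simplicial_complex K \<longleftrightarrow>
     {} \<in> K \<and> (\<forall>\<sigma>\<in>K. finite \<sigma>) \<and> (\<forall>\<sigma>\<in>K. \<forall>\<tau>. \<tau> \<subseteq> \<sigma> \<longrightarrow> \<tau> \<in> K)"

definition vertices :: "'a set set \<Rightarrow> 'a set" where
  "vertices K = \<Union>K"

text \<open>Only the values on the vertices of the source complex matter.\<close>

definition simplicial_map :: "('a \<Rightarrow> 'b) \<Rightarrow> 'a set set \<Rightarrow> 'b set set \<Rightarrow> bool" where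
  "simplicial_map f K L \<longleftrightarrow> (\<forall>\<sigma>\<in>K. f ` \<sigma> \<in> L)"

definition nondegenerate_map :: "('a \<Rightarrow> 'b) \<Rightarrow> 'a set set \<Rightarrow> bool" where
  "nondegenerate_map f K \<longleftrightarrow> (\<forall>\<sigma>\<in>K. inj_on f \<sigma>)"

abbreviation prime_field :: "nat \<Rightarrow> int ring" where
  "prime_field p \<equiv> residue_ring (int p)"

definition coord_space :: "nat \<Rightarrow> nat \<Rightarrow> (int, nat \<Rightarrow> int) module" where
  "coord_space p n = ring.func_space (prime_field p) {..<n}"

definition universal_complex :: "nat \<Rightarrow> nat \<Rightarrow> (nat \<Rightarrow> int) set set" where
  "universal_complex p n =
     {\<sigma>. \<sigma> \<subseteq> carrier (coord_space p n) - {\<zero>\<^bsub>coord_space p n\<^esub>} \<and>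
         module.lin_indpt (prime_field p) (coord_space p n) \<sigma>}"

text \<open>The invariant is meant for prime \<open>p\<close> and a finite simplicial complex \<open>K\<close>. The minimum is
  then attained, as mapping the \<open>m\<close> vertices of \<open>K\<close> to a basis of the \<open>m\<close>-dimensional space gives
  a nondegenerate map.\<close>

definition buchstaber :: "nat \<Rightarrow> 'a set set \<Rightarrow> int" where
  "buchstaber p K = int (card (vertices K)) -
     int (LEAST r. \<exists>f. simplicial_map f K (universal_complex p r) \<and> nondegenerate_map f K)"

lemma vectorspace_coord_space:
  assumes "prime p"
  shows "vectorspace (prime_field p) (coord_space p n)"
proof -
  interpret residues_prime p "prime_field p"
    using assms by unfold_locales auto
  have F: "Ring.field (prime_field p)"
    by (rule is_field)
  have "module (prime_field p) (coord_space p n)"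
    unfolding coord_space_def
    by (rule LinearCombinations.cring.func_space_is_module[OF cring])
  with F show ?thesis
    by (simp add: vectorspace_def)
qed

lemma finite_carrier_coord_space:
  assumes "prime p"
  shows "finite (carrier (coord_space p n))"
proof -
  interpret residues_prime p "prime_field p"
    using assms by unfold_locales auto
  show ?thesis
    unfolding coord_space_def func_space_def by (auto intro!: finite_PiE)
qed

lemma finite_universal_complex:
  assumes "prime p"
  shows "finite (universal_complex p n)"
  using finite_carrier_coord_space[OF assms]
  by (auto simp: universal_complex_def intro: finite_subset[of _ "Pow (carrier (coord_space p n))"])

lemma simplicial_complex_universal_complex:
  assumes "prime p"
  shows "simplicial_complex (universal_complex p n)"
proof -
  interpret vectorspace "prime_field p" "coord_space p n"
    by (rule vectorspace_coord_space[OF assms])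
  have "lin_indpt {}"
    by (simp add: lin_dep_def)
  moreover have "lin_indpt \<tau>" if "lin_indpt \<sigma>" "\<tau> \<subseteq> \<sigma>" for \<sigma> \<tau>
    using that unfolding lin_dep_def by (meson subset_trans)
  moreover have "finite \<sigma>" if "\<sigma> \<subseteq> carrier (coord_space p n) - {\<zero>\<^bsub>coord_space p n\<^esub>}" for \<sigma>
    using that finite_carrier_coord_space[OF assms] by (meson Diff_subset finite_subset)
  ultimately show ?thesis
    unfolding simplicial_complex_def universal_complex_def by blast
qed

lemma vertices_universal_complex:
  assumes "prime p"
  shows "vertices (universal_complex p n) = carrier (coord_space p n) - {\<zero>\<^bsub>coord_space p n\<^esub>}"
proof -
  interpret vectorspace "prime_field p" "coord_space p n"
    by (rule vectorspace_coord_space[OF assms])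
  have "{v} \<in> universal_complex p n"
    if v: "v \<in> carrier (coord_space p n)" "v \<noteq> \<zero>\<^bsub>coord_space p n\<^esub>" for v
  proof -
    have "lin_indpt {v}"
    proof (rule finite_lin_indpt2)
      fix a assume a: "a \<in> {v} \<rightarrow> carrier (prime_field p)"
        and z: "lincomb a {v} = \<zero>\<^bsub>coord_space p n\<^esub>"
      from a z v have z0: "a v \<odot>\<^bsub>coord_space p n\<^esub> v = \<zero>\<^bsub>coord_space p n\<^esub>"
        by (simp add: lincomb_def)
      with a v show "\<forall>w\<in>{v}. a w = \<zero>\<^bsub>prime_field p\<^esub>"
      proof (cases "a v = \<zero>\<^bsub>prime_field p\<^esub>")
        case False
        with a have u: "a v \<in> Units (prime_field p)" by (auto simp: field_Units)
        then have "inv\<^bsub>prime_field p\<^esub> (a v) \<odot>\<^bsub>coord_space p n\<^esub> (a v \<odot>\<^bsub>coord_space p n\<^esub> v) = v"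
          using a v smult_assoc1[of "inv\<^bsub>prime_field p\<^esub> (a v)" "a v" v] Units_l_inv smult_one by auto
        with z0 u v show ?thesis by (metis Units_inv_closed smult_r_null)
      qed auto
    qed (use v in auto)
    with v show ?thesis by (auto simp: universal_complex_def)
  qed
  then show ?thesis
    unfolding vertices_def by (auto simp: universal_complex_def)
qed

end

theory Submission
  imports Defs "Jordan_Normal_Form.Determinant"
begin

text \<open>The complex on the nonzero vectors of the binary space of dimension \<open>4\<close> has \<open>15\<close> vertices and
  simplices with \<open>4\<close> vertices, so the least target dimension \<open>r\<close> is at least \<open>4\<close>. The claim is that
  \<open>r = 4\<close> for \<open>p \<noteq> 3\<close> and \<open>r = 5\<close> for \<open>p = 3\<close>.

  For \<open>p \<noteq> 3\<close> one reads the 0/1 vectors modulo \<open>p\<close>. A binary basis has an odd determinant over the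
  integers, and a 0/1 matrix of size \<open>4\<close> has a determinant of absolute value at most \<open>4\<close>, so the
  determinant is \<open>1\<close> or \<open>3\<close> up to sign and stays nonzero modulo \<open>p\<close>
  (\<open>universal_complex_2_4_subset\<close>). For \<open>p = 3\<close> appending a coordinate equal to \<open>1\<close> gives a map to
  dimension \<open>5\<close> (\<open>affine_lift_independent_mod_3\<close>).

  What remains is that for \<open>p = 3\<close> there is no map \<open>f\<close> to dimension \<open>4\<close>
  (\<open>no_independent_map_to_ternary_4\<close>). Regard both spaces projectively. The points that \<open>f\<close> sends into a
  ternary plane lie in a binary plane, since a binary basis is sent to a basis. Through two image points
  pass exactly four ternary planes, which cover the space, and through the corresponding binary line
  pass three binary planes. A pigeonhole argument (\<open>kills_coset_or\<close>) shows that for each pair \<open>x\<close>,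
  \<open>y\<close> on the line, two of the three binary planes \<open>P\<close> have the property that the images of all
  points of \<open>P\<close> except \<open>x + y\<close> are coplanar. As a line has three such pairs, two of every three planes
  through a line are flat (\<open>flat_or\<close>), and intersecting two of these shows that \<open>f\<close> preserves
  collinearity (\<open>kills_line\<close>). But then \<open>f\<close> represents the Fano plane over the field with three
  elements, which is possible only in characteristic \<open>2\<close>.\<close>

section \<open>Linear independence modulo a prime\<close>

text \<open>Coefficients and entries are integers and only the congruence matters, so that one integer
  vector can be read modulo several primes. The vectors form an indexed family; for a vertex map
  \<open>f\<close> on a simplex \<open>\<sigma>\<close> the family \<open>f\<close> indexed by \<open>\<sigma>\<close> then records repeated images as well.\<close>

definition independent_mod :: "nat \<Rightarrow> nat \<Rightarrow> 'i set \<Rightarrow> ('i \<Rightarrow> nat \<Rightarrow> int) \<Rightarrow> bool" where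
  "independent_mod p n I w \<longleftrightarrow>
     (\<forall>c. (\<forall>j<n. int p dvd (\<Sum>i\<in>I. c i * w i j)) \<longrightarrow> (\<forall>i\<in>I. int p dvd c i))"

lemma independent_modD:
  assumes "independent_mod p n I w" "\<And>j. j < n \<Longrightarrow> int p dvd (\<Sum>i\<in>I. c i * w i j)" "i \<in> I"
  shows "int p dvd c i"
  using assms unfolding independent_mod_def by blast

lemma independent_modI:
  assumes "\<And>c i. (\<And>j. j < n \<Longrightarrow> int p dvd (\<Sum>i\<in>I. c i * w i j)) \<Longrightarrow> i \<in> I \<Longrightarrow> int p dvd c i"
  shows "independent_mod p n I w"
  using assms unfolding independent_mod_def by blast

lemma coord_space_simps:
  "carrier (coord_space p n) = {..<n} \<rightarrow>\<^sub>E {0..int p - 1}"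
  "\<zero>\<^bsub>coord_space p n\<^esub> = (\<lambda>j\<in>{..<n}. 0)"
  "v \<oplus>\<^bsub>coord_space p n\<^esub> w = (\<lambda>j\<in>{..<n}. (v j + w j) mod int p)"
  "a \<odot>\<^bsub>coord_space p n\<^esub> v = (\<lambda>j\<in>{..<n}. (a * v j) mod int p)"
  if "prime p"
proof -
  interpret residues_prime p "prime_field p"
    using that by unfold_locales auto
  show "carrier (coord_space p n) = {..<n} \<rightarrow>\<^sub>E {0..int p - 1}"
    "\<zero>\<^bsub>coord_space p n\<^esub> = (\<lambda>j\<in>{..<n}. 0)"
    "v \<oplus>\<^bsub>coord_space p n\<^esub> w = (\<lambda>j\<in>{..<n}. (v j + w j) mod int p)"
    "a \<odot>\<^bsub>coord_space p n\<^esub> v = (\<lambda>j\<in>{..<n}. (a * v j) mod int p)"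
    unfolding coord_space_def func_space_def by (simp_all add: residue_ring_def)
qed

lemma lincomb_coord_space:
  assumes p: "prime p" and "finite A" "A \<subseteq> carrier (coord_space p n)"
    and "a \<in> A \<rightarrow> carrier (prime_field p)"
  shows "module.lincomb (coord_space p n) a A = (\<lambda>j\<in>{..<n}. (\<Sum>v\<in>A. a v * v j) mod int p)"
proof -
  interpret vectorspace "prime_field p" "coord_space p n"
    by (rule vectorspace_coord_space[OF p])
  show ?thesis
    using assms(2-)
  proof (induction A rule: finite_induct)
    case empty
    then show ?case by (simp add: lincomb_def coord_space_simps[OF p])
  next
    case (insert v A)
    have "lincomb a (insert v A) = a v \<odot>\<^bsub>coord_space p n\<^esub> v \<oplus>\<^bsub>coord_space p n\<^esub> lincomb a A"
      using insert lincomb_insert[of A a v] by auto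
    also have "\<dots> = (\<lambda>j\<in>{..<n}. (\<Sum>v\<in>insert v A. a v * v j) mod int p)"
      using insert by (auto simp: coord_space_simps[OF p] mod_simps restrict_def fun_eq_iff)
    finally show ?case .
  qed
qed

lemma lin_indpt_iff_independent_mod:
  assumes p: "prime p" and "finite \<sigma>" and sub: "\<sigma> \<subseteq> carrier (coord_space p n)"
  shows "module.lin_indpt (prime_field p) (coord_space p n) \<sigma> \<longleftrightarrow> independent_mod p n \<sigma> (\<lambda>v. v)"
proof -
  interpret vectorspace "prime_field p" "coord_space p n"
    by (rule vectorspace_coord_space[OF p])
  have p1: "1 < int p" using prime_gt_1_nat[OF p] by simp
  have carr: "carrier (prime_field p) = {0..int p - 1}" "\<zero>\<^bsub>prime_field p\<^esub> = 0"
    by (simp_all add: residue_ring_def)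
  have zero_iff: "lincomb a \<sigma> = \<zero>\<^bsub>coord_space p n\<^esub> \<longleftrightarrow> (\<forall>j<n. int p dvd (\<Sum>v\<in>\<sigma>. a v * v j))"
    if "a \<in> \<sigma> \<rightarrow> carrier (prime_field p)" for a
    using lincomb_coord_space[OF p \<open>finite \<sigma>\<close> sub that] p1
    by (auto simp: coord_space_simps[OF p] fun_eq_iff restrict_def dvd_eq_mod_eq_0 split: if_splits)
  show ?thesis
  proof
    assume li: "lin_indpt \<sigma>"
    show "independent_mod p n \<sigma> (\<lambda>v. v)"
    proof (rule independent_modI)
      fix c v assume c: "\<And>j. j < n \<Longrightarrow> int p dvd (\<Sum>v\<in>\<sigma>. c v * v j)" and v: "v \<in> \<sigma>"
      define a where "a = (\<lambda>v. c v mod int p)"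
      have a: "a \<in> \<sigma> \<rightarrow> carrier (prime_field p)"
        using p1 by (auto simp: a_def carr)
      have "(\<Sum>v\<in>\<sigma>. a v * v j) mod int p = (\<Sum>v\<in>\<sigma>. c v * v j) mod int p" for j
        unfolding a_def cong_def[symmetric] by (intro cong_sum cong_mult) (auto simp: cong_def)
      then have "lincomb a \<sigma> = \<zero>\<^bsub>coord_space p n\<^esub>"
        using c zero_iff[OF a] by (simp add: dvd_eq_mod_eq_0)
      then have "a v = 0"
        using li v a lin_dep_crit[OF \<open>finite \<sigma>\<close>, of \<sigma> a v] carr by auto
      then show "int p dvd c v" by (auto simp: a_def)
    qed
  next
    assume ind: "independent_mod p n \<sigma> (\<lambda>v. v)"
    show "lin_indpt \<sigma>"
    proof (rule finite_lin_indpt2[OF \<open>finite \<sigma>\<close> sub])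
      fix a assume a: "a \<in> \<sigma> \<rightarrow> carrier (prime_field p)" and "lincomb a \<sigma> = \<zero>\<^bsub>coord_space p n\<^esub>"
      then have "\<forall>v\<in>\<sigma>. int p dvd a v"
        using zero_iff[OF a] ind by (auto simp: independent_mod_def)
      with a show "\<forall>v\<in>\<sigma>. a v = \<zero>\<^bsub>prime_field p\<^esub>"
        unfolding carr by (metis atLeastAtMost_iff funcset_mem zdvd_not_zless zle_diff1_eq order_le_less)
    qed
  qed
qed

lemma independent_mod_image:
  assumes "inj_on f I"
  shows "independent_mod p n (f ` I) w \<longleftrightarrow> independent_mod p n I (\<lambda>i. w (f i))"
proof
  assume ind: "independent_mod p n (f ` I) w"
  show "independent_mod p n I (\<lambda>i. w (f i))"
  proof (rule independent_modI)
    fix c i assume c: "\<And>j. j < n \<Longrightarrow> int p dvd (\<Sum>i\<in>I. c i * w (f i) j)" and i: "i \<in> I"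
    have "int p dvd (\<Sum>k\<in>f ` I. c (the_inv_into I f k) * w k j)" if "j < n" for j
      using c[OF that] assms by (simp add: sum.reindex the_inv_into_f_f)
    from independent_modD[OF ind this, of "f i"] i show "int p dvd c i"
      by (simp add: the_inv_into_f_f assms)
  qed
next
  assume ind: "independent_mod p n I (\<lambda>i. w (f i))"
  show "independent_mod p n (f ` I) w"
  proof (rule independent_modI)
    fix c k assume c: "\<And>j. j < n \<Longrightarrow> int p dvd (\<Sum>k\<in>f ` I. c k * w k j)" and "k \<in> f ` I"
    then obtain i where "i \<in> I" "k = f i" by blast
    moreover have "int p dvd (\<Sum>i\<in>I. c (f i) * w (f i) j)" if "j < n" for j
      using c[OF that] assms by (simp add: sum.reindex)
    ultimately show "int p dvd c k"
      using independent_modD[OF ind, of "\<lambda>i. c (f i)"] by blast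
  qed
qed

lemma independent_mod_inj_on:
  assumes ind: "independent_mod p n I w" and "finite I" and p: "p \<noteq> 1"
  shows "inj_on w I"
proof (rule inj_onI, rule ccontr)
  fix i k assume ik: "i \<in> I" "k \<in> I" "w i = w k" "i \<noteq> k"
  define c where "c = (\<lambda>l. if l = i then 1 else if l = k then - 1 else 0 :: int)"
  have "(\<Sum>l\<in>I. c l * w l j) = 0" for j
  proof -
    have "(\<Sum>l\<in>I. c l * w l j) = (\<Sum>l\<in>{i, k}. c l * w l j)"
      using ik \<open>finite I\<close> by (intro sum.mono_neutral_right) (auto simp: c_def)
    then show ?thesis using ik by (simp add: c_def)
  qed
  then have "int p dvd c i"
    using independent_modD[OF ind, of c i] ik by simp
  then show False using p by (simp add: c_def)
qed

lemma independent_mod_nonzero: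
  assumes ind: "independent_mod p n I w" and "finite I" and p: "p \<noteq> 1" and "i \<in> I"
  shows "\<exists>j<n. w i j \<noteq> 0"
proof (rule ccontr)
  assume "\<not> ?thesis"
  then have "(\<Sum>l\<in>I. of_bool (l = i) * w l j) = 0" if "j < n" for j
    using that by (intro sum.neutral) auto
  then have "int p dvd of_bool (i = i)"
    using independent_modD[OF ind, of "\<lambda>l. of_bool (l = i)" i] \<open>i \<in> I\<close> by simp
  then show False using p by simp
qed

lemma universal_complex_iff:
  assumes p: "prime p"
  shows "\<sigma> \<in> universal_complex p n \<longleftrightarrow>
    \<sigma> \<subseteq> carrier (coord_space p n) \<and> independent_mod p n \<sigma> (\<lambda>v. v)" (is "?L \<longleftrightarrow> ?R")
proof -
  have p1: "p \<noteq> 1" using p by auto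
  have fin: "finite \<sigma>" if "\<sigma> \<subseteq> carrier (coord_space p n)"
    using finite_subset[OF that finite_carrier_coord_space[OF p]] .
  have "\<zero>\<^bsub>coord_space p n\<^esub> \<notin> \<sigma>" if "?R"
    using independent_mod_nonzero[of p n \<sigma> "\<lambda>v. v" "\<lambda>j\<in>{..<n}. 0"] that fin p1
    by (auto simp: coord_space_simps[OF p])
  then show ?thesis
    using lin_indpt_iff_independent_mod[OF p fin, of n] fin
    unfolding universal_complex_def by blast
qed

text \<open>Two vertices with the same image satisfy the relation with coefficients \<open>1\<close> and \<open>-1\<close>, so
  independence of the family already contains injectivity of \<open>f\<close> on the simplex.\<close>

lemma nondegenerate_simplicial_iff:
  assumes p: "prime p" and fin: "\<And>\<sigma>. \<sigma> \<in> K \<Longrightarrow> finite \<sigma>"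
  shows "simplicial_map f K (universal_complex p r) \<and> nondegenerate_map f K \<longleftrightarrow>
    (\<forall>\<sigma>\<in>K. f ` \<sigma> \<subseteq> carrier (coord_space p r) \<and> independent_mod p r \<sigma> f)"
proof -
  have "p \<noteq> 1" using p by auto
  then have "f ` \<sigma> \<in> universal_complex p r \<and> inj_on f \<sigma> \<longleftrightarrow>
      f ` \<sigma> \<subseteq> carrier (coord_space p r) \<and> independent_mod p r \<sigma> f" if "\<sigma> \<in> K" for \<sigma>
    using independent_mod_inj_on[of p r \<sigma> f] independent_mod_image[of f \<sigma> p r "\<lambda>v. v"] fin[OF that]
    unfolding universal_complex_iff[OF p] by blast
  then show ?thesis
    unfolding simplicial_map_def nondegenerate_map_def by blast
qed

section \<open>Counting linear combinations\<close>

text \<open>The difference of two coefficient vectors with the same combination is a relation. Comparing the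
  \<open>p\<close>-power cardinalities of both sides of this injection replaces dimension theory below.\<close>

lemma combination_inj_on:
  assumes ind: "independent_mod p n I w"
  shows "inj_on (\<lambda>c. \<lambda>j\<in>{..<n}. (\<Sum>i\<in>I. c i * w i j) mod int p) (I \<rightarrow>\<^sub>E {0..<int p})"
proof (rule inj_onI)
  fix c d assume cd: "c \<in> I \<rightarrow>\<^sub>E {0..<int p}" "d \<in> I \<rightarrow>\<^sub>E {0..<int p}"
    and eq: "(\<lambda>j\<in>{..<n}. (\<Sum>i\<in>I. c i * w i j) mod int p) = (\<lambda>j\<in>{..<n}. (\<Sum>i\<in>I. d i * w i j) mod int p)"
  have "int p dvd (\<Sum>i\<in>I. (c i - d i) * w i j)" if "j < n" for j
    using fun_cong[OF eq, of j] that
    by (simp add: left_diff_distrib sum_subtractf mod_eq_dvd_iff)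
  then have "int p dvd c i - d i" if "i \<in> I" for i
    using independent_modD[OF ind, of "\<lambda>i. c i - d i"] that by blast
  then have "c i = d i" if "i \<in> I" for i
    using that cd by (metis PiE_mem atLeastLessThan_iff mod_eq_dvd_iff mod_pos_pos_trivial)
  then show "c = d" using cd by (auto intro: PiE_ext)
qed

lemma combination_range:
  assumes "1 < p"
  shows "(\<lambda>c. \<lambda>j\<in>{..<n}. (\<Sum>i\<in>I. c i * w i j) mod int p) ` C \<subseteq> {..<n} \<rightarrow>\<^sub>E {0..<int p}"
proof (rule image_subsetI)
  fix c
  show "(\<lambda>j\<in>{..<n}. (\<Sum>i\<in>I. c i * w i j) mod int p) \<in> {..<n} \<rightarrow>\<^sub>E {0..<int p}"
    using assms by (intro restrict_PiE_iff[THEN iffD2]) simp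
qed

lemma independent_mod_card_le:
  assumes "independent_mod p n I w" "finite I" "1 < p"
  shows "card I \<le> n"
proof -
  have "card (I \<rightarrow>\<^sub>E {0..<int p}) \<le> card ({..<n} \<rightarrow>\<^sub>E {0..<int p})"
    using \<open>1 < p\<close>
    by (intro card_inj_on_le[OF combination_inj_on[OF assms(1)] combination_range]) (auto intro: finite_PiE)
  then show ?thesis using assms by (simp add: card_PiE)
qed

text \<open>An injection between finite sets of the same size \<open>p ^ n\<close> is onto.\<close>

lemma independent_mod_spans:
  assumes "independent_mod p n I w" "finite I" "card I = n" "1 < p"
  obtains c where "\<And>j. j < n \<Longrightarrow> [(\<Sum>i\<in>I. c i * w i j) = t j] (mod int p)"
proof -
  let ?F = "\<lambda>c. \<lambda>j\<in>{..<n}. (\<Sum>i\<in>I. c i * w i j) mod int p"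
  have "?F ` (I \<rightarrow>\<^sub>E {0..<int p}) = {..<n} \<rightarrow>\<^sub>E {0..<int p}"
    using assms(2-)
    by (intro card_subset_eq combination_range)
      (auto intro: finite_PiE simp: card_image[OF combination_inj_on[OF assms(1)]] card_PiE)
  moreover have "(\<lambda>j\<in>{..<n}. t j mod int p) \<in> {..<n} \<rightarrow>\<^sub>E {0..<int p}"
    using assms by auto
  ultimately have "(\<lambda>j\<in>{..<n}. t j mod int p) \<in> ?F ` (I \<rightarrow>\<^sub>E {0..<int p})" by (simp only:)
  then obtain c where eq: "?F c = (\<lambda>j\<in>{..<n}. t j mod int p)" by (metis (no_types, lifting) imageE)
  show ?thesis
  proof (rule that)
    fix j assume "j < n"
    then show "[(\<Sum>i\<in>I. c i * w i j) = t j] (mod int p)"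
      using fun_cong[OF eq, of j] by (simp add: cong_def)
  qed
qed

text \<open>A set of fewer than \<open>n\<close> vectors has fewer than \<open>p ^ n\<close> combinations, so some vector is not
  a combination; in a relation involving it, its coefficient cannot be invertible modulo \<open>p\<close>.\<close>

lemma independent_mod_extend:
  assumes p: "prime p" and ind: "independent_mod p n \<sigma> (\<lambda>v. v)" and "finite \<sigma>" and lt: "card \<sigma> < n"
  obtains v where "v \<in> carrier (coord_space p n)" "v \<notin> \<sigma>" "independent_mod p n (insert v \<sigma>) (\<lambda>v. v)"
proof -
  let ?C = "\<sigma> \<rightarrow>\<^sub>E {0..<int p}"
  let ?F = "\<lambda>c. \<lambda>j\<in>{..<n}. (\<Sum>v\<in>\<sigma>. c v * v j) mod int p"
  have p1: "1 < p" using prime_gt_1_nat[OF p] .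
  have "card (?F ` ?C) \<le> card ?C"
    by (rule card_image_le) (use \<open>finite \<sigma>\<close> in \<open>auto intro: finite_PiE\<close>)
  also have "\<dots> < card ({..<n} \<rightarrow>\<^sub>E {0..<int p})"
    using \<open>finite \<sigma>\<close> lt p1 by (simp add: card_PiE)
  finally have "\<not> {..<n} \<rightarrow>\<^sub>E {0..<int p} \<subseteq> ?F ` ?C"
    using card_mono[of "?F ` ?C"] \<open>finite \<sigma>\<close> by (meson finite_PiE finite_atLeastLessThan_int finite_imageI leD)
  then obtain t where t: "t \<in> {..<n} \<rightarrow>\<^sub>E {0..<int p}" "t \<notin> ?F ` ?C" by blast
  have notcomb: "\<exists>j<n. \<not> [(\<Sum>v\<in>\<sigma>. c v * v j) = t j] (mod int p)" for c
  proof (rule ccontr)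
    assume *: "\<not> ?thesis"
    have "(\<Sum>v\<in>\<sigma>. (\<lambda>v\<in>\<sigma>. c v mod int p) v * v j) mod int p = t j" if "j < n" for j
    proof -
      have "[(\<Sum>v\<in>\<sigma>. (\<lambda>v\<in>\<sigma>. c v mod int p) v * v j) = (\<Sum>v\<in>\<sigma>. c v * v j)] (mod int p)"
        by (intro cong_sum cong_mult) (auto simp: cong_def)
      also have "[(\<Sum>v\<in>\<sigma>. c v * v j) = t j] (mod int p)" using * that by blast
      finally show ?thesis using t(1) that by (auto simp: cong_def PiE_iff)
    qed
    then have "t = ?F (\<lambda>v\<in>\<sigma>. c v mod int p)"
      using t(1) by (auto simp: fun_eq_iff PiE_iff extensional_def)
    moreover have "(\<lambda>v\<in>\<sigma>. c v mod int p) \<in> ?C" using p1 by auto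
    ultimately show False using t(2) by blast
  qed
  have "t \<notin> \<sigma>"
  proof
    assume "t \<in> \<sigma>"
    then have "(\<Sum>v\<in>\<sigma>. of_bool (v = t) * v j) = t j" for j
      using \<open>finite \<sigma>\<close> by (simp add: of_bool_def if_distrib[of "\<lambda>x. x * _"] sum.delta cong: if_cong)
    then show False using notcomb[of "\<lambda>v. of_bool (v = t)"] by simp
  qed
  moreover have "independent_mod p n (insert t \<sigma>) (\<lambda>v. v)"
  proof (rule independent_modI)
    fix c i assume c: "\<And>j. j < n \<Longrightarrow> int p dvd (\<Sum>v\<in>insert t \<sigma>. c v * v j)" and i: "i \<in> insert t \<sigma>"
    have rel: "int p dvd c t * t j + (\<Sum>v\<in>\<sigma>. c v * v j)" if "j < n" for j
      using c[OF that] \<open>finite \<sigma>\<close> \<open>t \<notin> \<sigma>\<close> by simp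
    have "int p dvd c t"
    proof (rule ccontr)
      assume "\<not> int p dvd c t"
      then have "coprime (c t) (int p)"
        using p by (simp add: coprime_commute prime_imp_coprime)
      then obtain e where e: "[c t * e = 1] (mod int p)" by (metis cong_solve_coprime_int)
      have "[(\<Sum>v\<in>\<sigma>. (- e * c v) * v j) = t j] (mod int p)" if "j < n" for j
      proof -
        have eq: "(\<Sum>v\<in>\<sigma>. (- e * c v) * v j) - t j =
            t j * (c t * e - 1) - e * (c t * t j + (\<Sum>v\<in>\<sigma>. c v * v j))"
          by (simp add: algebra_simps sum_distrib_left sum_negf)
        show ?thesis
          unfolding cong_iff_dvd_diff eq
          by (rule dvd_diff[OF dvd_mult[OF e[unfolded cong_iff_dvd_diff]] dvd_mult[OF rel[OF that]]])
      qed
      with notcomb[of "\<lambda>v. - e * c v"] show False by (elim exE conjE) (rule notE)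
    qed
    moreover have "int p dvd (\<Sum>v\<in>\<sigma>. c v * v j)" if "j < n" for j
      using rel[OF that] dvd_mult2[OF calculation] by (simp add: dvd_add_right_iff)
    then have "int p dvd c v" if "v \<in> \<sigma>" for v
      using that by (rule independent_modD[OF ind])
    ultimately show "int p dvd c i"
      using i by auto
  qed
  moreover have "t \<in> carrier (coord_space p n)"
    using t(1) by (auto simp: coord_space_simps[OF p] PiE_iff)
  ultimately show ?thesis using that by blast
qed

section \<open>Independence and determinants\<close>

abbreviation column_mat :: "nat \<Rightarrow> (nat \<Rightarrow> nat \<Rightarrow> int) \<Rightarrow> int mat" where
  "column_mat n w \<equiv> mat n n (\<lambda>(j, i). w i j)"

lemma det_cong:
  fixes A B :: "int mat"
  assumes "A \<in> carrier_mat n n" "B \<in> carrier_mat n n"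
    and "\<And>i j. i < n \<Longrightarrow> j < n \<Longrightarrow> [A $$ (i, j) = B $$ (i, j)] (mod m)"
  shows "[det A = det B] (mod m)"
  unfolding det_def'[OF assms(1)] det_def'[OF assms(2)]
  by (intro cong_sum cong_mult cong_prod cong_refl assms(3)) (auto simp: permutes_in_image)

text \<open>An independent family of \<open>n\<close> vectors spans, so its matrix has an inverse modulo \<open>p\<close> and its
  determinant is a unit there. Conversely the adjugate turns a relation into divisibility of
  \<open>det * c i\<close>.\<close>

lemma independent_mod_iff_det:
  assumes p: "prime p"
  shows "independent_mod p n {..<n} w \<longleftrightarrow> \<not> int p dvd det (column_mat n w)"
proof
  let ?B = "column_mat n w"
  have p1: "1 < p" using prime_gt_1_nat[OF p] .
  assume ind: "independent_mod p n {..<n} w"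
  have "\<exists>c. \<forall>j<n. [(\<Sum>i<n. c i * w i j) = of_bool (j = k)] (mod int p)" for k
    by (rule independent_mod_spans[OF ind finite_lessThan card_lessThan p1, of "\<lambda>j. of_bool (j = k)"])
      blast
  then obtain c where c: "\<And>k j. j < n \<Longrightarrow> [(\<Sum>i<n. c k i * w i j) = of_bool (j = k)] (mod int p)"
    by metis
  let ?C = "column_mat n c"
  have "[det (?B * ?C) = det (1\<^sub>m n)] (mod int p)"
  proof (rule det_cong[of _ n])
    fix j k assume jk: "j < n" "k < n"
    then have "(?B * ?C) $$ (j, k) = (\<Sum>i<n. c k i * w i j)"
      by (simp add: scalar_prod_def mult.commute atLeast0LessThan)
    with c[of j k] jk show "[(?B * ?C) $$ (j, k) = 1\<^sub>m n $$ (j, k)] (mod int p)"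
      by (simp add: of_bool_def)
  qed auto
  then have "[det ?B * det ?C = 1] (mod int p)"
    by (simp add: det_mult[of ?B n ?C])
  then show "\<not> int p dvd det ?B"
    using p1 by (metis cong_dvd_iff dvd_mult2 int_dvd_int_iff nat_dvd_1_iff_1 of_nat_1 less_irrefl)
next
  let ?B = "column_mat n w"
  assume ndvd: "\<not> int p dvd det ?B"
  show "independent_mod p n {..<n} w"
  proof (rule independent_modI)
    fix c i assume c: "\<And>j. j < n \<Longrightarrow> int p dvd (\<Sum>i<n. c i * w i j)" and i: "i \<in> {..<n}"
    have BB: "?B \<in> carrier_mat n n" by simp
    note adj = adj_mat[OF BB]
    define x where "x = vec n c"
    have x: "x \<in> carrier_vec n" by (simp add: x_def)
    have "det ?B * c i = ((det ?B \<cdot>\<^sub>m 1\<^sub>m n) *\<^sub>v x) $ i"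
      using i by (simp add: x_def)
    also have "(det ?B \<cdot>\<^sub>m 1\<^sub>m n) *\<^sub>v x = adj_mat ?B *\<^sub>v (?B *\<^sub>v x)"
      unfolding adj(3)[symmetric] using adj(1) BB x by (rule assoc_mult_mat_vec)
    also have "\<dots> $ i = (\<Sum>j<n. adj_mat ?B $$ (i, j) * (\<Sum>i<n. c i * w i j))"
      using i adj(1) by (auto simp: scalar_prod_def x_def mult.commute atLeast0LessThan intro!: sum.cong)
    finally have "int p dvd det ?B * c i"
      using c by (auto intro!: dvd_sum)
    with ndvd p show "int p dvd c i"
      by (simp add: prime_dvd_mult_iff)
  qed
qed

lemma independent_mod_transpose:
  assumes "prime p"
  shows "independent_mod p n {..<n} (\<lambda>i j. w j i) \<longleftrightarrow> independent_mod p n {..<n} w"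
proof -
  have "column_mat n (\<lambda>i j. w j i) = transpose_mat (column_mat n w)"
    by (rule eq_matI) auto
  then show ?thesis
    by (simp add: independent_mod_iff_det[OF assms] det_transpose[of _ n])
qed

section \<open>Determinants of 0/1 matrices of size 4\<close>

definition binary_mat :: "int mat \<Rightarrow> bool" where
  "binary_mat A \<longleftrightarrow> (\<forall>i<dim_row A. \<forall>j<dim_col A. A $$ (i, j) \<in> {0, 1})"

lemma abs_det_le_row_sum:
  fixes A :: "int mat"
  assumes A: "A \<in> carrier_mat n n" and k: "k < n"
    and M: "\<And>j. j < n \<Longrightarrow> \<bar>det (mat_delete A k j)\<bar> \<le> M"
  shows "\<bar>det A\<bar> \<le> (\<Sum>j<n. \<bar>A $$ (k, j)\<bar>) * M"
proof -
  have "\<bar>det A\<bar> \<le> (\<Sum>j<n. \<bar>A $$ (k, j) * cofactor A k j\<bar>)"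
    unfolding laplace_expansion_row[OF A k] by (rule sum_abs)
  also have "\<dots> = (\<Sum>j<n. \<bar>A $$ (k, j)\<bar> * \<bar>det (mat_delete A k j)\<bar>)"
    by (simp add: cofactor_def abs_mult power_abs)
  also have "\<dots> \<le> (\<Sum>j<n. \<bar>A $$ (k, j)\<bar> * M)"
    by (intro sum_mono mult_left_mono M) auto
  finally show ?thesis by (simp add: sum_distrib_right)
qed

lemma binary_mat_delete:
  assumes "binary_mat A" "A \<in> carrier_mat n n"
  shows "binary_mat (mat_delete A k j)"
  using assms unfolding binary_mat_def mat_delete_def by auto

text \<open>Laplace expansion along a row with at most two nonzero entries, all of them \<open>1\<close> or \<open>-1\<close>, costs
  a factor of two. If no row of \<open>A\<close> is that sparse, then, as \<open>n \<le> 4\<close>, each row has at most one zero,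
  and the difference of two rows is sparse.\<close>

lemma abs_det_binary_step:
  assumes A: "A \<in> carrier_mat n n" "binary_mat A" and n: "2 \<le> n" "n \<le> 4"
    and M: "\<And>B. B \<in> carrier_mat (n - 1) (n - 1) \<Longrightarrow> binary_mat B \<Longrightarrow> \<bar>det B\<bar> \<le> M"
  shows "\<bar>det A\<bar> \<le> 2 * M"
proof -
  have del: "\<bar>det (mat_delete A k j)\<bar> \<le> M" if "k < n" "j < n" for k j
    using that A n by (intro M binary_mat_delete) (auto simp: mat_delete_carrier)
  have M0: "0 \<le> M" using del[of 0 0] n by simp
  have bin: "A $$ (k, j) \<in> {0, 1}" if "k < n" "j < n" for k j
    using A that by (auto simp: binary_mat_def)
  show ?thesis
  proof (cases "\<exists>k<n. (\<Sum>j<n. \<bar>A $$ (k, j)\<bar>) \<le> 2")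
    case True
    then obtain k where k: "k < n" "(\<Sum>j<n. \<bar>A $$ (k, j)\<bar>) \<le> 2" by blast
    have "\<bar>det A\<bar> \<le> (\<Sum>j<n. \<bar>A $$ (k, j)\<bar>) * M"
      by (rule abs_det_le_row_sum[OF A(1) k(1)]) (use del k in auto)
    also have "\<dots> \<le> 2 * M" using k M0 by (intro mult_right_mono)
    finally show ?thesis .
  next
    case False
    then have big: "3 \<le> (\<Sum>j<n. A $$ (k, j))" if "k < n" for k
    proof -
      have "(\<Sum>j<n. \<bar>A $$ (k, j)\<bar>) = (\<Sum>j<n. A $$ (k, j))"
      proof (rule sum.cong)
        fix j assume "j \<in> {..<n}"
        then show "\<bar>A $$ (k, j)\<bar> = A $$ (k, j)" using bin[of k j] that by auto
      qed simp
      moreover have "\<not> (\<Sum>j<n. \<bar>A $$ (k, j)\<bar>) \<le> 2"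
        using False that by blast
      ultimately show ?thesis by linarith
    qed
    let ?A = "addrow (- 1) 0 1 A"
    have row: "?A $$ (0, j) = A $$ (0, j) - A $$ (1, j)" if "j < n" for j
      using that A n by (auto simp: mat_addrow_gen_def)
    have le: "\<bar>A $$ (0, j) - A $$ (1, j)\<bar> \<le> 2 - A $$ (0, j) - A $$ (1, j)" if "j < n" for j
      using bin[of 0 j] bin[of 1 j] that n by auto
    have "(\<Sum>j<n. \<bar>?A $$ (0, j)\<bar>) \<le> (\<Sum>j<n. 2 - A $$ (0, j) - A $$ (1, j))"
      by (rule sum_mono) (use row le in auto)
    also have "\<dots> = 2 * int n - (\<Sum>j<n. A $$ (0, j)) - (\<Sum>j<n. A $$ (1, j))"
      by (simp add: sum_subtractf)
    also have "\<dots> \<le> 2" using big[of 0] big[of 1] n by simp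
    finally have *: "(\<Sum>j<n. \<bar>?A $$ (0, j)\<bar>) \<le> 2" .
    have "mat_delete ?A 0 j = mat_delete A 0 j" for j
      using A by (intro eq_matI) (auto simp: mat_delete_def mat_addrow_gen_def)
    then have "\<bar>det ?A\<bar> \<le> (\<Sum>j<n. \<bar>?A $$ (0, j)\<bar>) * M"
      using del n A by (intro abs_det_le_row_sum) (auto simp: mat_addrow_gen_def)
    also have "\<dots> \<le> 2 * M" using * M0 by (intro mult_right_mono)
    finally show ?thesis using det_addrow[of 1 n 0 A "- 1"] A n by simp
  qed
qed

text \<open>The true maximum is \<open>3\<close>; the weaker bound suffices because it is used for odd determinants.\<close>

lemma abs_det_binary_4:
  assumes "A \<in> carrier_mat 4 4" "binary_mat A"
  shows "\<bar>det A\<bar> \<le> 4"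
proof -
  have two: "\<bar>det B\<bar> \<le> 1" if B: "B \<in> carrier_mat 2 2" "binary_mat B" for B
  proof -
    have "det B = B $$ (0, 0) * B $$ (1, 1) - B $$ (0, 1) * B $$ (1, 0)"
      using B(1) laplace_expansion_row[OF B(1), of 0]
      by (simp add: lessThan_Suc numeral_2_eq_2 cofactor_def mat_delete_def det_single)
    moreover have "B $$ (i, j) \<in> {0, 1}" if "i < 2" "j < 2" for i j
      using that B by (auto simp: binary_mat_def)
    note this[of 0 0] this[of 0 1] this[of 1 0] this[of 1 1]
    ultimately show ?thesis by auto
  qed
  have three: "\<bar>det B\<bar> \<le> 2" if "B \<in> carrier_mat 3 3" "binary_mat B" for B
    using abs_det_binary_step[OF that, of 1] two by simp
  show ?thesis
    using abs_det_binary_step[OF assms, of 2] three by simp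
qed

section \<open>Simplices of the universal complexes\<close>

lemma universal_complexD:
  assumes "prime p" "\<sigma> \<in> universal_complex p n"
  shows "\<sigma> \<subseteq> {..<n} \<rightarrow>\<^sub>E {0..int p - 1}" "independent_mod p n \<sigma> (\<lambda>v. v)" "finite \<sigma>" "card \<sigma> \<le> n"
proof -
  show car: "\<sigma> \<subseteq> {..<n} \<rightarrow>\<^sub>E {0..int p - 1}" and ind: "independent_mod p n \<sigma> (\<lambda>v. v)"
    using assms by (auto simp: universal_complex_iff coord_space_simps)
  show fin: "finite \<sigma>"
    using car by (rule finite_subset) (auto intro: finite_PiE)
  show "card \<sigma> \<le> n"
    using independent_mod_card_le[OF ind fin] prime_gt_1_nat[OF assms(1)] .
qed

lemma universal_complex_extend:
  assumes p: "prime p" and "\<sigma> \<in> universal_complex p n"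
  obtains \<tau> where "\<tau> \<in> universal_complex p n" "\<sigma> \<subseteq> \<tau>" "card \<tau> = n"
proof -
  have "\<exists>\<tau>\<in>universal_complex p n. \<sigma> \<subseteq> \<tau> \<and> card \<tau> = n"
    using assms(2)
  proof (induction "n - card \<sigma>" arbitrary: \<sigma>)
    case 0
    then show ?case using universal_complexD(4)[OF p 0(2)] by auto
  next
    case (Suc k)
    note \<sigma> = universal_complexD[OF p Suc.prems]
    obtain v where v: "v \<in> carrier (coord_space p n)" "v \<notin> \<sigma>" "independent_mod p n (insert v \<sigma>) (\<lambda>v. v)"
      by (rule independent_mod_extend[OF p \<sigma>(2,3)]) (use Suc.hyps(2) in auto)
    have "insert v \<sigma> \<in> universal_complex p n"
      using v \<sigma>(1) by (simp add: universal_complex_iff[OF p] coord_space_simps[OF p])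
    moreover have "k = n - card (insert v \<sigma>)"
      using Suc.hyps(2) v(2) \<sigma>(3) by simp
    ultimately show ?case using Suc.hyps(1)[of "insert v \<sigma>"] by blast
  qed
  then show ?thesis using that by blast
qed

lemma empty_in_universal_complex:
  assumes "prime p"
  shows "{} \<in> universal_complex p n"
  using simplicial_complex_universal_complex[OF assms] by (simp add: simplicial_complex_def)

lemma card_vertices_universal_complex_2_4: "card (vertices (universal_complex 2 4)) = 15"
proof -
  have p: "prime (2::nat)" by simp
  have "card ({..<4::nat} \<rightarrow>\<^sub>E {0..int 2 - 1}) = 16"
    by (simp add: card_PiE)
  then show ?thesis
    unfolding vertices_universal_complex[OF p] coord_space_simps[OF p]
    by (subst card_Diff_singleton) auto
qed

section \<open>Maps in the existence direction\<close>

text \<open>Reading 0/1 vectors modulo \<open>p\<close> preserves independence: a binary basis has an odd determinant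
  of absolute value at most \<open>4\<close>, hence \<open>1\<close> or \<open>3\<close>, and \<open>p\<close> divides neither.\<close>

lemma universal_complex_2_4_subset:
  assumes p: "prime p" and "p \<noteq> 3"
  shows "universal_complex 2 4 \<subseteq> universal_complex p 4"
proof
  fix \<sigma> assume "\<sigma> \<in> universal_complex 2 4"
  have two: "prime (2::nat)" by simp
  obtain \<tau> where \<tau>: "\<tau> \<in> universal_complex 2 4" "\<sigma> \<subseteq> \<tau>" "card \<tau> = 4"
    by (rule universal_complex_extend[OF two \<open>\<sigma> \<in> _\<close>])
  note \<tau>D = universal_complexD[OF two \<tau>(1)]
  obtain w where w: "bij_betw w {..<4::nat} \<tau>"
    using ex_bij_betw_nat_finite[OF \<tau>D(3)] \<tau>(3) by (auto simp: atLeast0LessThan)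
  have inj: "inj_on w {..<4}" and img: "w ` {..<4} = \<tau>"
    using w by (auto simp: bij_betw_def)
  have ind_iff: "independent_mod q 4 \<tau> (\<lambda>v. v) \<longleftrightarrow> \<not> int q dvd det (column_mat 4 w)" if "prime q" for q
    using independent_mod_image[OF inj, of q 4 "\<lambda>v. v"] independent_mod_iff_det[OF that, of 4 w]
    by (simp add: img)
  define d where "d = det (column_mat 4 w)"
  have "odd d"
    using ind_iff[OF two] \<tau>D(2) by (simp add: d_def)
  moreover have "\<bar>d\<bar> \<le> 4"
    unfolding d_def
  proof (rule abs_det_binary_4)
    have "w i j \<in> {0, 1}" if "i < 4" "j < 4" for i j
    proof -
      have "w i \<in> {..<4} \<rightarrow>\<^sub>E {0..int 2 - 1}" using img \<tau>D(1) that by blast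
      then have "w i j \<in> {0..int 2 - 1}" using that by (auto simp: PiE_iff)
      then show ?thesis by auto
    qed
    then show "binary_mat (column_mat 4 w)" by (simp add: binary_mat_def)
  qed simp
  ultimately have "d \<in> {-3, -1, 1, 3}" by (auto simp: abs_le_iff elim!: oddE) presburger
  moreover have "\<not> int p dvd 1" "\<not> int p dvd 3"
    using p \<open>p \<noteq> 3\<close> primes_dvd_imp_eq[of "int p" 3] by (auto simp: prime_int_numeral_eq)
  ultimately have "\<not> int p dvd d" by auto
  then have "independent_mod p 4 \<tau> (\<lambda>v. v)"
    using ind_iff[OF p] by (simp add: d_def)
  moreover have "{..<4::nat} \<rightarrow>\<^sub>E {0..int 2 - 1} \<subseteq> {..<4} \<rightarrow>\<^sub>E {0..int p - 1}"
    using prime_gt_1_nat[OF p] by (intro PiE_mono) auto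
  ultimately have "\<tau> \<in> universal_complex p 4"
    using \<tau>D(1) by (auto simp: universal_complex_iff[OF p] coord_space_simps[OF p])
  with \<tau>(2) show "\<sigma> \<in> universal_complex p 4"
    using simplicial_complex_universal_complex[OF p] by (auto simp: simplicial_complex_def)
qed

text \<open>For \<open>p = 3\<close> a binary basis with determinant \<open>3\<close> or \<open>-3\<close>, such as the four vectors with exactly
  one zero, becomes dependent. An extra coordinate \<open>1\<close> repairs this: it forces the coefficients
  \<open>1\<close> and \<open>-1\<close> of a ternary relation to balance modulo \<open>3\<close>. With at most four vectors, either
  there are equally many of each sign, at most two, and each coordinate of the relation is too small
  to be a nonzero multiple of \<open>3\<close>, so the relation holds over the integers and hence modulo \<open>2\<close>;
  or three vectors sum to zero modulo \<open>3\<close>, which for 0/1 vectors makes them equal.\<close>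

lemma affine_lift_independent_mod_3:
  assumes \<sigma>: "\<sigma> \<in> universal_complex 2 4"
  shows "independent_mod 3 5 \<sigma> (\<lambda>v. \<lambda>j\<in>{..<5}. if j < 4 then v j else 1)"
proof (rule independent_modI)
  have two: "prime (2::nat)" by simp
  note \<sigma>D = universal_complexD[OF two \<sigma>]
  have bin: "v j \<in> {0, 1}" if "v \<in> \<sigma>" "j < 4" for v j
  proof -
    have "v j \<in> {0..int 2 - 1}" using that \<sigma>D(1) by (auto simp: PiE_iff)
    then show ?thesis by auto
  qed
  fix c x assume c: "\<And>j. j < 5 \<Longrightarrow>
      int 3 dvd (\<Sum>v\<in>\<sigma>. c v * (\<lambda>j\<in>{..<5}. if j < 4 then v j else 1) j)" and x: "x \<in> \<sigma>"
  \<comment> \<open>the residue of \<open>c v\<close> in \<open>{-1, 0, 1}\<close>\<close>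
  define e where "e = (\<lambda>v. (c v + 1) mod 3 - 1)"
  have e_cong: "[e v = c v] (mod 3)" for v
    unfolding e_def cong_iff_dvd_diff by presburger
  have e_range: "e v = 0 \<or> e v = 1 \<or> e v = - 1" for v
    unfolding e_def by presburger
  have e_dvd: "3 dvd (\<Sum>v\<in>\<sigma>. e v * h v)" if "3 dvd (\<Sum>v\<in>\<sigma>. c v * h v)" for h
  proof -
    have "[(\<Sum>v\<in>\<sigma>. e v * h v) = (\<Sum>v\<in>\<sigma>. c v * h v)] (mod 3)"
      by (intro cong_sum cong_mult e_cong cong_refl)
    with that show ?thesis by (simp add: cong_dvd_iff)
  qed
  define P N where "P = {v\<in>\<sigma>. e v = 1}" and "N = {v\<in>\<sigma>. e v = - 1}"
  have PN: "P \<subseteq> \<sigma>" "N \<subseteq> \<sigma>" "P \<inter> N = {}" "finite P" "finite N"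
    using \<sigma>D(3) by (auto simp: P_def N_def)
  have split: "(\<Sum>v\<in>\<sigma>. e v * h v) = sum h P - sum h N" for h
  proof -
    have "(\<Sum>v\<in>\<sigma>. e v * h v) = (\<Sum>v\<in>P \<union> N. e v * h v)"
      using \<sigma>D(3) e_range by (intro sum.mono_neutral_right) (auto simp: P_def N_def)
    also have "\<dots> = (\<Sum>v\<in>P. e v * h v) + (\<Sum>v\<in>N. e v * h v)"
      using PN by (intro sum.union_disjoint) auto
    also have "\<dots> = sum h P - sum h N"
      by (simp add: P_def N_def sum_negf)
    finally show ?thesis .
  qed
  have coord: "3 dvd (\<Sum>v\<in>P. v j) - (\<Sum>v\<in>N. v j)" if "j < 4" for j
    using e_dvd[of "\<lambda>v. v j"] c[of j] that by (simp add: split)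
  have affine: "3 dvd int (card P) - int (card N)"
    using e_dvd[of "\<lambda>v. 1"] c[of 4] split[of "\<lambda>v. 1"] by simp
  have small: "card P + card N \<le> 4"
    using card_mono[of \<sigma> "P \<union> N"] \<sigma>D(3,4) PN by (simp add: card_Un_disjoint)
  have bounds: "0 \<le> (\<Sum>v\<in>T. v j)" "(\<Sum>v\<in>T. v j) \<le> int (card T)" if "T \<subseteq> \<sigma>" "j < 4" for T j
    using sum_mono[of T "\<lambda>v. 0" "\<lambda>v. v j"] sum_mono[of T "\<lambda>v. v j" "\<lambda>v. 1"] that bin[of _ j]
    by (fastforce simp: subset_iff)+
  have no_triple: False if T: "T \<subseteq> \<sigma>" "card T = 3" "\<And>j. j < 4 \<Longrightarrow> 3 dvd (\<Sum>v\<in>T. v j)" for T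
  proof -
    have fT: "finite T" using T(1) \<sigma>D(3) finite_subset by blast
    have eq: "u j = v j" if "u \<in> T" "v \<in> T" "j < 4" for u v j
    proof (rule ccontr)
      assume "u j \<noteq> v j"
      then have uv: "u j + v j = 1" "u \<noteq> v" using bin[OF subsetD[OF T(1)], of u j] bin[OF subsetD[OF T(1)], of v j] that by auto
      have "card (T - {u, v}) = 1"
        using that uv(2) T(2) fT by (simp add: card_Diff_subset)
      then have "(\<Sum>v\<in>T - {u, v}. v j) \<in> {0, 1}"
        using bounds[of "T - {u, v}" j, OF order_trans[OF Diff_subset T(1)] \<open>j < 4\<close>] by auto
      moreover have "(\<Sum>v\<in>T. v j) = (\<Sum>v\<in>T - {u, v}. v j) + (\<Sum>v\<in>{u, v}. v j)"
        using that fT by (intro sum.subset_diff) auto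
      ultimately have "(\<Sum>v\<in>T. v j) \<in> {1, 2}" using uv by auto
      then show False using T(3)[OF \<open>j < 4\<close>] by auto
    qed
    have "u = v" if "u \<in> T" "v \<in> T" for u v
    proof (rule PiE_ext[of _ "{..<4}" "\<lambda>_. {0..int 2 - 1}"])
      show "u \<in> {..<4} \<rightarrow>\<^sub>E {0..int 2 - 1}" "v \<in> {..<4} \<rightarrow>\<^sub>E {0..int 2 - 1}"
        using that T(1) \<sigma>D(1) by blast+
    qed (use eq that in auto)
    then have "card T \<le> 1" by (auto simp: card_le_Suc0_iff_eq[OF fT])
    then show False using T(2) by simp
  qed
  have "card P = card N \<or> card P = 3 \<and> card N = 0 \<or> card P = 0 \<and> card N = 3"
    using affine small by presburger
  then have eqc: "card P = card N"
    using no_triple[OF PN(1)] no_triple[OF PN(2)] coord PN(4,5) by auto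
  have "(\<Sum>v\<in>P. v j) - (\<Sum>v\<in>N. v j) = 0" if "j < 4" for j
    using coord[OF that] bounds[OF PN(1) that] bounds[OF PN(2) that] eqc small by presburger
  then have "int 2 dvd (\<Sum>v\<in>\<sigma>. e v * v j)" if "j < 4" for j
    using that by (simp add: split)
  then have "int 2 dvd e x"
    using independent_modD[OF \<sigma>D(2)] x by blast
  then have "e x = 0" using e_range[of x] by auto
  then show "int 3 dvd c x" using cong_dvd_iff[OF e_cong[of x]] by simp
qed

section \<open>Binary frames\<close>

definition frame :: "(nat \<Rightarrow> int) \<Rightarrow> (nat \<Rightarrow> int) \<Rightarrow> (nat \<Rightarrow> int) \<Rightarrow> (nat \<Rightarrow> int) \<Rightarrow> bool" where
  "frame x y a b \<longleftrightarrow> distinct [x, y, a, b] \<and> {x, y, a, b} \<in> universal_complex 2 4"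

definition bin_add :: "(nat \<Rightarrow> int) \<Rightarrow> (nat \<Rightarrow> int) \<Rightarrow> nat \<Rightarrow> int" (infixl "\<boxplus>" 65) where
  "v \<boxplus> w = (\<lambda>j\<in>{..<4}. (v j + w j) mod 2)"

lemma bin_add_commute: "v \<boxplus> w = w \<boxplus> v"
  by (simp add: bin_add_def add.commute)

lemma bin_add_assoc: "(u \<boxplus> v) \<boxplus> w = u \<boxplus> (v \<boxplus> w)"
  by (auto simp: bin_add_def restrict_def fun_eq_iff mod_simps add.assoc)

lemma bin_add_left_commute: "u \<boxplus> (v \<boxplus> w) = v \<boxplus> (u \<boxplus> w)"
  by (metis bin_add_assoc bin_add_commute)

lemmas bin_add_ac = bin_add_assoc bin_add_commute bin_add_left_commute

lemma bin_add_cancel: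
  assumes "v \<in> {..<4} \<rightarrow>\<^sub>E {0..1}"
  shows "u \<boxplus> (u \<boxplus> v) = v"
proof
  fix j
  have "(u j + (u j + v j) mod 2) mod 2 = v j" if "j < 4"
  proof -
    have "v j \<in> {0..1}" using assms that by (auto simp: PiE_iff)
    then show ?thesis by (auto) presburger
  qed
  then show "(u \<boxplus> (u \<boxplus> v)) j = v j"
    using assms by (auto simp: bin_add_def PiE_iff extensional_def)
qed

lemma bin_add_self_right:
  assumes "v \<in> {..<4} \<rightarrow>\<^sub>E {0..1}"
  shows "v \<boxplus> (u \<boxplus> u) = v"
  using bin_add_cancel[OF assms, of u] by (simp add: bin_add_ac)

text \<open>Modulo \<open>3\<close> the vectors \<open>(1, 0)\<close>, \<open>(0, 1)\<close>, \<open>(1, 1)\<close>, \<open>(1, -1)\<close> represent all four points of the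
  projective line, so every pair \<open>(s, t)\<close> is orthogonal to one of them.\<close>

lemma dvd_3_sign_combination:
  fixes s t e :: int
  assumes "e = 1 \<or> e = - 1"
  shows "3 dvd s \<Longrightarrow> 3 dvd s + e * t \<longleftrightarrow> 3 dvd t" "3 dvd t \<Longrightarrow> 3 dvd s + e * t \<longleftrightarrow> 3 dvd s"
    "3 dvd s \<or> 3 dvd t \<or> 3 dvd s + e * t \<or> 3 dvd s + (- e) * t"
    "3 dvd s + e * t \<Longrightarrow> 3 dvd s \<longleftrightarrow> 3 dvd t"
proof -
  from assms show "3 dvd s \<Longrightarrow> 3 dvd s + e * t \<longleftrightarrow> 3 dvd t"
    by (rule disjE) (simp, presburger)+
  from assms show "3 dvd t \<Longrightarrow> 3 dvd s + e * t \<longleftrightarrow> 3 dvd s"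
    by (rule disjE) (simp, presburger)+
  from assms show "3 dvd s \<or> 3 dvd t \<or> 3 dvd s + e * t \<or> 3 dvd s + (- e) * t"
    by (rule disjE) (simp, presburger)+
  from assms show "3 dvd s + e * t \<Longrightarrow> 3 dvd s \<longleftrightarrow> 3 dvd t"
    by (rule disjE) (simp, presburger)+
qed

text \<open>The simplex condition in terms of four separate coefficients, for checking that elementary
  operations preserve frames.\<close>

lemma frame_iff:
  "frame x y a b \<longleftrightarrow> {x, y, a, b} \<subseteq> {..<4} \<rightarrow>\<^sub>E {0..1} \<and>
     (\<forall>c1 c2 c3 c4. (\<forall>j<4. even (c1 * x j + c2 * y j + c3 * a j + c4 * b j)) \<longrightarrow>
        even c1 \<and> even c2 \<and> even c3 \<and> even c4)" (is "_ \<longleftrightarrow> ?C \<and> ?I")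
proof
  have two: "prime (2::nat)" by simp
  have sum4: "(\<Sum>v\<in>{x, y, a, b}. h v) = h x + h y + h a + h b"
    if "distinct [x, y, a, b]" for h :: "(nat \<Rightarrow> int) \<Rightarrow> int"
    using that by (auto simp: add.assoc)
  {
    assume fr: "frame x y a b"
    then have d: "distinct [x, y, a, b]" and u: "{x, y, a, b} \<in> universal_complex 2 4"
      by (auto simp: frame_def)
    note ind = universal_complexD(2)[OF two u]
    have ?I
    proof (intro allI impI)
      fix c1 c2 c3 c4 :: int
      assume c: "\<forall>j<4. even (c1 * x j + c2 * y j + c3 * a j + c4 * b j)"
      define c where "c = (\<lambda>v. if v = x then c1 else if v = y then c2 else if v = a then c3 else c4)"
      have cv: "c x = c1" "c y = c2" "c a = c3" "c b = c4"
        using d by (auto simp: c_def)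
      have "int 2 dvd (\<Sum>v\<in>{x, y, a, b}. c v * v j)" if "j < 4" for j
        unfolding sum4[OF d] cv using c that by simp
      then have "int 2 dvd c v" if "v \<in> {x, y, a, b}" for v
        using that by (rule independent_modD[OF ind])
      from this[of x] this[of y] this[of a] this[of b]
      show "even c1 \<and> even c2 \<and> even c3 \<and> even c4"
        by (simp add: cv)
    qed
    moreover have ?C using universal_complexD(1)[OF two u] by simp
    ultimately show "?C \<and> ?I" by blast
  next
    assume *: "?C \<and> ?I"
    then have I: "even c1 \<and> even c2 \<and> even c3 \<and> even c4"
      if "\<And>j. j < 4 \<Longrightarrow> even (c1 * x j + c2 * y j + c3 * a j + c4 * b j)" for c1 c2 c3 c4
      using that by blast
    have d: "distinct [x, y, a, b]"
      using I[of 1 1 0 0] I[of 1 0 1 0] I[of 1 0 0 1] I[of 0 1 1 0] I[of 0 1 0 1] I[of 0 0 1 1]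
      by auto
    moreover have "independent_mod 2 4 {x, y, a, b} (\<lambda>v. v)"
    proof (rule independent_modI)
      fix c v assume c: "\<And>j. j < 4 \<Longrightarrow> int 2 dvd (\<Sum>v\<in>{x, y, a, b}. c v * v j)"
        and v: "v \<in> {x, y, a, b}"
      show "int 2 dvd c v"
        using I[of "c x" "c y" "c a" "c b"] c[unfolded sum4[OF d]] v by auto
    qed
    ultimately show "frame x y a b"
      using * by (simp add: frame_def universal_complex_iff[OF two] coord_space_simps[OF two])
  }
qed

lemma frame_swap:
  assumes "frame x y a b"
  shows "frame y x a b" "frame x a y b" "frame x y b a"
  using assms by (auto simp: frame_def insert_commute)

lemma bin_add_closed: "v \<boxplus> w \<in> {..<4} \<rightarrow>\<^sub>E {0..1}"
  by (auto simp: bin_add_def PiE_iff)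

lemma frame_add:
  assumes "frame x y a b"
  shows "frame (x \<boxplus> y) y a b"
  unfolding frame_iff
proof (intro conjI allI impI)
  show "{x \<boxplus> y, y, a, b} \<subseteq> {..<4} \<rightarrow>\<^sub>E {0..1}"
    using assms bin_add_closed by (simp add: frame_iff)
  fix c1 c2 c3 c4 :: int
  assume c: "\<forall>j<4. even (c1 * (x \<boxplus> y) j + c2 * y j + c3 * a j + c4 * b j)"
  have "even (c1 * x j + (c1 + c2) * y j + c3 * a j + c4 * b j)" if "j < 4" for j
    using c that by (auto simp: bin_add_def)
  then have "even c1 \<and> even (c1 + c2) \<and> even c3 \<and> even c4"
    using assms unfolding frame_iff by blast
  then show "even c1" "even c2" "even c3" "even c4" by auto
qed

lemma frame_cancel:
  assumes "frame x y a b"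
  shows "x \<boxplus> (x \<boxplus> y) = y"
  using assms by (intro bin_add_cancel) (simp add: frame_iff)

lemma frame_shears:
  assumes "frame x y a b"
  shows "frame x y (a \<boxplus> x) b" "frame x y (a \<boxplus> y) b" "frame x y a (a \<boxplus> b)"
    "frame x (x \<boxplus> y) a b" "frame y (x \<boxplus> y) a b"
proof -
  note S = frame_swap
  show "frame x y (a \<boxplus> x) b" by (metis assms S frame_add)
  show "frame x y (a \<boxplus> y) b" by (metis assms S frame_add)
  show "frame x y a (a \<boxplus> b)" by (metis assms S frame_add bin_add_commute)
  show "frame x (x \<boxplus> y) a b" by (metis assms S frame_add bin_add_commute)
  show "frame y (x \<boxplus> y) a b" by (metis assms S frame_add)
qed

text \<open>If \<open>x\<close>, \<open>y\<close>, \<open>a\<close> are independent, these are the points of the binary projective plane through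
  \<open>x\<close>, \<open>y\<close>, \<open>a\<close> that lie off the line through \<open>x\<close> and \<open>y\<close>.\<close>

definition coset :: "(nat \<Rightarrow> int) \<Rightarrow> (nat \<Rightarrow> int) \<Rightarrow> (nat \<Rightarrow> int) \<Rightarrow> (nat \<Rightarrow> int) set" where
  "coset x y a = {a, a \<boxplus> x, a \<boxplus> y, a \<boxplus> (x \<boxplus> y)}"

lemma frame_coset:
  assumes "frame x y a b" "u \<in> coset x y a"
  shows "frame x y u b"
  using assms(2) unfolding coset_def
  by (metis assms(1) bin_add_assoc empty_iff frame_shears(1,2) insert_iff)

lemma coset_line:
  assumes "frame x y a b"
  shows "coset x (x \<boxplus> y) a = coset x y a" "coset y (x \<boxplus> y) a = coset x y a"
proof -
  have "x \<boxplus> (x \<boxplus> y) = y" "y \<boxplus> (x \<boxplus> y) = x"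
    using frame_cancel[OF assms] frame_cancel[OF frame_swap(1)[OF assms]]
    by (simp_all add: bin_add_commute)
  then show "coset x (x \<boxplus> y) a = coset x y a" "coset y (x \<boxplus> y) a = coset x y a"
    unfolding coset_def by auto
qed

section \<open>No map to the ternary space of dimension 4\<close>

text \<open>Everything is phrased through the linear functionals on the ternary space, given by integer
  coefficient vectors, and the set of binary points that they annihilate. Frames are mapped to bases,
  so a functional may be prescribed freely on a frame, and one that annihilates a frame annihilates
  everything. Equivalently, the points annihilated by a nonzero functional lie in one binary plane.\<close>

context
  fixes f :: "(nat \<Rightarrow> int) \<Rightarrow> nat \<Rightarrow> int"
  assumes independent: "\<And>\<sigma>. \<sigma> \<in> universal_complex 2 4 \<Longrightarrow> independent_mod 3 4 \<sigma> f"
begin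

definition pairing :: "(nat \<Rightarrow> int) \<Rightarrow> (nat \<Rightarrow> int) \<Rightarrow> int" where
  "pairing \<phi> v = (\<Sum>j<4. \<phi> j * f v j)"

definition kills :: "(nat \<Rightarrow> int) \<Rightarrow> (nat \<Rightarrow> int) \<Rightarrow> bool" where
  "kills \<phi> v \<longleftrightarrow> 3 dvd pairing \<phi> v"

lemma pairing_combination:
  obtains \<chi> where "\<And>v. pairing \<chi> v = pairing \<phi> v + k * pairing \<psi> v"
  by (rule that[of "\<lambda>j. \<phi> j + k * \<psi> j"])
    (simp add: pairing_def distrib_right sum.distrib sum_distrib_left mult.assoc)

lemma pairing_difference:
  obtains \<chi> where "\<And>v. pairing \<chi> v = pairing \<phi> v - pairing \<psi> v"
proof -
  obtain \<chi> where "\<And>v. pairing \<chi> v = pairing \<phi> v + (- 1) * pairing \<psi> v"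
    using pairing_combination[of \<phi> "- 1" \<psi>] by blast
  then show ?thesis by (intro that[of \<chi>]) simp
qed

text \<open>A square matrix with independent rows has independent columns, which is what both the existence
  and the uniqueness of functionals with given values on a frame need.\<close>

lemma frame_dual_independent:
  assumes "frame x y a b"
  shows "independent_mod 3 4 {..<4} (\<lambda>j i. f ([x, y, a, b] ! i) j)"
proof -
  let ?L = "[x, y, a, b]"
  have "inj_on ((!) ?L) {..<4}"
    using assms by (intro inj_on_nth) (auto simp: frame_def)
  moreover have "(!) ?L ` {..<4} = {x, y, a, b}"
    by (simp add: lessThan_Suc eval_nat_numeral insert_commute)
  ultimately have "independent_mod 3 4 {..<4} (\<lambda>i. f (?L ! i))"
    using independent[of "{x, y, a, b}"] assms independent_mod_image[of "(!) ?L" "{..<4}" 3 4 f]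
    by (simp add: frame_def)
  then show ?thesis
    using independent_mod_transpose[of 3 4 "\<lambda>i. f (?L ! i)"] by simp
qed

lemma functional_on_frame:
  assumes "frame x y a b"
  obtains \<phi> where "[pairing \<phi> x = s] (mod 3)" "[pairing \<phi> y = t] (mod 3)"
    "[pairing \<phi> a = k] (mod 3)" "[pairing \<phi> b = l] (mod 3)"
proof -
  obtain \<phi> where "\<And>i. i < 4 \<Longrightarrow>
      [(\<Sum>j<4. \<phi> j * f ([x, y, a, b] ! i) j) = [s, t, k, l] ! i] (mod int 3)"
    by (rule independent_mod_spans[OF frame_dual_independent[OF assms], of "\<lambda>i. [s, t, k, l] ! i"]) auto
  from this[of 0] this[of 1] this[of 2] this[of 3] show ?thesis
    by (intro that[of \<phi>]) (simp_all add: pairing_def)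
qed

lemma kills_frame_imp_kills:
  assumes fr: "frame x y a b" and k: "kills \<phi> x" "kills \<phi> y" "kills \<phi> a" "kills \<phi> b"
  shows "kills \<phi> v"
proof -
  have "int 3 dvd (\<Sum>j<4. \<phi> j * f ([x, y, a, b] ! i) j)" if "i < 4" for i
  proof -
    have "i \<in> {0, 1, 2, 3}" using that by auto
    then show ?thesis using k by (auto simp: kills_def pairing_def)
  qed
  then have "3 dvd \<phi> j" if "j < 4" for j
    using independent_modD[OF frame_dual_independent[OF fr]] that by simp
  then show ?thesis by (auto simp: kills_def pairing_def intro!: dvd_sum)
qed

text \<open>Up to sign four functionals annihilate \<open>x\<close> and \<open>y\<close>, and every point is annihilated by one of
  them. Each of them meets only one of the three planes through the line of \<open>x\<close> and \<open>y\<close> outside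
  this line, and each plane needs at least one. Four functionals for three planes leave at least two
  planes with a single one, which then annihilates all points of the plane off the line.\<close>

lemma kills_coset_or:
  assumes fr: "frame x y a b"
  shows "(\<exists>\<phi>. kills \<phi> x \<and> kills \<phi> y \<and> (\<forall>u\<in>coset x y a. kills \<phi> u) \<and> \<not> kills \<phi> b) \<or>
    (\<exists>\<phi>. kills \<phi> x \<and> kills \<phi> y \<and> (\<forall>w\<in>coset x y b. kills \<phi> w) \<and> \<not> kills \<phi> a)"
proof -
  define c where "c = a \<boxplus> b"
  have fr': "frame x y b a" "frame x y a c" "frame x y b c"
    using fr frame_swap(3)[OF fr] frame_shears(3)[OF fr] frame_shears(3)[OF frame_swap(3)[OF fr]]
    by (simp_all add: c_def bin_add_commute)
  have frames: "frame x y u w" "frame x y u c" "frame x y w c"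
    if "u \<in> coset x y a" "w \<in> coset x y b" for u w
    using that fr fr' frame_coset frame_swap(3) by blast+
  have base: "a \<in> coset x y a" "b \<in> coset x y b" by (auto simp: coset_def)
  obtain \<phi> where \<phi>: "[pairing \<phi> x = 0] (mod 3)" "[pairing \<phi> y = 0] (mod 3)"
      "[pairing \<phi> a = 0] (mod 3)" "[pairing \<phi> b = 1] (mod 3)"
    by (rule functional_on_frame[OF fr])
  obtain \<psi> where \<psi>: "[pairing \<psi> x = 0] (mod 3)" "[pairing \<psi> y = 0] (mod 3)"
      "[pairing \<psi> a = 1] (mod 3)" "[pairing \<psi> b = 0] (mod 3)"
    by (rule functional_on_frame[OF fr])
  have \<phi>k: "kills \<phi> x" "kills \<phi> y" "kills \<phi> a" "\<not> kills \<phi> b"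
    using \<phi> unfolding kills_def cong_def by presburger+
  have \<psi>k: "kills \<psi> x" "kills \<psi> y" "\<not> kills \<psi> a" "kills \<psi> b"
    using \<psi> unfolding kills_def cong_def by presburger+
  have \<phi>n: "\<not> kills \<phi> w" if "w \<in> coset x y b" for w
    using kills_frame_imp_kills[OF frames(1)[OF base(1) that]] \<phi>k by blast
  have \<psi>n: "\<not> kills \<psi> u" if "u \<in> coset x y a" for u
    using kills_frame_imp_kills[OF frames(1)[OF that base(2)]] \<psi>k by blast
  have "\<not> kills \<phi> c" "\<not> kills \<psi> c"
    using kills_frame_imp_kills[OF fr'(2)] kills_frame_imp_kills[OF fr'(3)] \<phi>k \<psi>k by blast+
  \<comment> \<open>One of \<open>\<phi> + \<psi>\<close> and \<open>\<phi> - \<psi>\<close> is taken by the third plane, the one through \<open>c\<close>; the other, \<open>\<chi>'\<close>,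
    is the only one that can share a plane with \<open>\<phi>\<close> or with \<open>\<psi>\<close>.\<close>
  then have "3 dvd pairing \<phi> c + 1 * pairing \<psi> c \<or> 3 dvd pairing \<phi> c + (- 1) * pairing \<psi> c"
    unfolding kills_def by presburger
  then obtain e where e: "e = 1 \<or> e = - 1" "3 dvd pairing \<phi> c + e * pairing \<psi> c" by blast
  obtain \<chi> where \<chi>: "\<And>v. pairing \<chi> v = pairing \<phi> v + e * pairing \<psi> v"
    using pairing_combination[of \<phi> e \<psi>] by blast
  obtain \<chi>' where \<chi>': "\<And>v. pairing \<chi>' v = pairing \<phi> v + (- e) * pairing \<psi> v"
    using pairing_combination[of \<phi> "- e" \<psi>] by blast
  have \<chi>k: "kills \<chi> x" "kills \<chi> y" "kills \<chi> c" "\<not> kills \<chi> a" "\<not> kills \<chi> b"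
    using e(2) \<phi>k \<psi>k unfolding kills_def \<chi> by (simp_all add: dvd_3_sign_combination(1,2)[OF e(1)])
  have e': "- e = 1 \<or> - e = - 1" using e(1) by auto
  have \<chi>'k: "kills \<chi>' x" "kills \<chi>' y" "\<not> kills \<chi>' a"
    using \<phi>k \<psi>k unfolding kills_def \<chi>' by (simp_all add: dvd_3_sign_combination(1,2)[OF e'] del: mult_minus_left)
  have \<chi>n: "\<not> kills \<chi> u" "\<not> kills \<chi> w" if "u \<in> coset x y a" "w \<in> coset x y b" for u w
    using kills_frame_imp_kills[OF frames(2)[OF that]] kills_frame_imp_kills[OF frames(3)[OF that]] \<chi>k
    by blast+
  have some: "kills \<phi> v \<or> kills \<psi> v \<or> kills \<chi> v \<or> kills \<chi>' v" for v
    unfolding kills_def \<chi> \<chi>' by (rule dvd_3_sign_combination(3)[OF e(1)])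
  show ?thesis
  proof (cases "\<exists>u\<in>coset x y a. kills \<chi>' u")
    case True
    then obtain u where u: "u \<in> coset x y a" "kills \<chi>' u" by blast
    have "kills \<psi> w" if w: "w \<in> coset x y b" for w
    proof -
      have "\<not> kills \<chi>' w"
        using kills_frame_imp_kills[OF frames(1)[OF u(1) w]] \<chi>'k u(2) by blast
      with some[of w] \<phi>n[OF w] \<chi>n(2)[OF base(1) w] show ?thesis by blast
    qed
    with \<psi>k show ?thesis by blast
  next
    case False
    then have "kills \<phi> u" if "u \<in> coset x y a" for u
      using some[of u] \<psi>n[OF that] \<chi>n(1)[OF that base(2)] that by blast
    with \<phi>k show ?thesis by blast
  qed
qed

text \<open>The coset contains three independent points, and with \<open>b\<close> they form a frame. So functionals that
  annihilate the coset but not \<open>b\<close> agree up to sign.\<close>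

lemma kills_same:
  assumes fr: "frame x y a b"
    and \<phi>: "\<forall>u\<in>coset x y a. kills \<phi> u" "\<not> kills \<phi> b"
    and \<psi>: "\<forall>u\<in>coset x y a. kills \<psi> u" "\<not> kills \<psi> b"
  shows "kills \<phi> v \<longleftrightarrow> kills \<psi> v"
proof -
  have "frame a (a \<boxplus> x) (a \<boxplus> y) b"
    by (rule frame_swap(2)[OF frame_shears(4)[OF frame_swap(2)[OF frame_shears(4)[OF
          frame_swap(1)[OF frame_swap(2)[OF fr]]]]]])
  moreover have "3 dvd pairing \<phi> b + 1 * pairing \<psi> b \<or> 3 dvd pairing \<phi> b + (- 1) * pairing \<psi> b"
    using \<phi>(2) \<psi>(2) unfolding kills_def by presburger
  then obtain e where e: "e = 1 \<or> e = - 1" "3 dvd pairing \<phi> b + e * pairing \<psi> b" by blast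
  obtain \<chi> where \<chi>: "\<And>v. pairing \<chi> v = pairing \<phi> v + e * pairing \<psi> v"
    using pairing_combination[of \<phi> e \<psi>] by blast
  have "kills \<chi> a" "kills \<chi> (a \<boxplus> x)" "kills \<chi> (a \<boxplus> y)" "kills \<chi> b"
    using \<phi>(1) \<psi>(1) e(2) unfolding kills_def \<chi> coset_def by auto
  ultimately have "kills \<chi> v" by (metis kills_frame_imp_kills)
  then show ?thesis unfolding kills_def \<chi> by (rule dvd_3_sign_combination(4)[OF e(1)])
qed

text \<open>For independent \<open>x\<close>, \<open>y\<close>, \<open>a\<close>: a ternary plane contains the images of the binary line through
  \<open>x\<close> and \<open>y\<close> and of one more point.\<close>

definition flat :: "(nat \<Rightarrow> int) \<Rightarrow> (nat \<Rightarrow> int) \<Rightarrow> (nat \<Rightarrow> int) \<Rightarrow> bool" where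
  "flat x y a \<longleftrightarrow>
     (\<exists>\<phi>. kills \<phi> x \<and> kills \<phi> y \<and> kills \<phi> (x \<boxplus> y) \<and> kills \<phi> a \<and> (\<exists>v. \<not> kills \<phi> v))"

text \<open>The previous alternative applies to each of the three pairs of points of the line, so two of the
  pairs choose the same plane. Their functionals agree up to sign and together annihilate the line.\<close>

lemma flat_or:
  assumes fr: "frame x y a b"
  shows "flat x y a \<or> flat x y b"
proof -
  let ?z = "x \<boxplus> y"
  define K where "K = (\<lambda>x' y' a b. \<exists>\<phi>. kills \<phi> x' \<and> kills \<phi> y' \<and>
    (\<forall>u\<in>coset x y a. kills \<phi> u) \<and> \<not> kills \<phi> b)"
  have fr': "frame x y b a" by (rule frame_swap(3)[OF fr])
  have "K x y a b \<or> K x y b a"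
    unfolding K_def by (rule kills_coset_or[OF fr])
  moreover have "K x ?z a b \<or> K x ?z b a"
    using kills_coset_or[OF frame_shears(4)[OF fr]] coset_line(1)[OF fr] coset_line(1)[OF fr']
    unfolding K_def by simp
  moreover have "K y ?z a b \<or> K y ?z b a"
    using kills_coset_or[OF frame_shears(5)[OF fr]] coset_line(2)[OF fr] coset_line(2)[OF fr']
    unfolding K_def by simp
  moreover have flat: "flat x y a"
    if "frame x y a b" "K x1 x2 a b" "K y1 y2 a b" "{x, y, ?z} = {x1, x2, y1, y2}" for a b x1 x2 y1 y2
  proof -
    obtain \<phi> where \<phi>: "kills \<phi> x1" "kills \<phi> x2" "\<forall>u\<in>coset x y a. kills \<phi> u" "\<not> kills \<phi> b"
      using \<open>K x1 x2 a b\<close> unfolding K_def by blast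
    obtain \<psi> where \<psi>: "kills \<psi> y1" "kills \<psi> y2" "\<forall>u\<in>coset x y a. kills \<psi> u" "\<not> kills \<psi> b"
      using \<open>K y1 y2 a b\<close> unfolding K_def by blast
    have "kills \<phi> v" if "v \<in> {x, y, ?z}" for v
      using that kills_same[OF \<open>frame x y a b\<close> \<phi>(3,4) \<psi>(3,4)] \<phi>(1,2) \<psi>(1,2)
      unfolding \<open>{x, y, ?z} = _\<close> by blast
    then show ?thesis
      using \<phi>(3,4) unfolding flat_def coset_def by blast
  qed
  note flat[OF fr, of x y x ?z] flat[OF fr, of x y y ?z] flat[OF fr, of x ?z y ?z]
    flat[OF fr', of x y x ?z] flat[OF fr', of x y y ?z] flat[OF fr', of x ?z y ?z]
  ultimately show ?thesis
    by (auto simp: insert_commute)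
qed

text \<open>Two flat planes through the line give functionals that annihilate the line but are nonzero at \<open>v\<close>
  and at \<open>u\<close> respectively. Subtracting multiples of them from \<open>\<chi>\<close> yields a functional that vanishes
  on a frame, without changing \<open>\<chi>\<close> on the line.\<close>

lemma flat_planes_imp_collinear:
  assumes fr: "frame x y u v" and "flat x y u" "flat x y v" and \<chi>: "kills \<chi> x" "kills \<chi> y"
  shows "kills \<chi> (x \<boxplus> y)"
proof -
  obtain \<phi> where \<phi>: "kills \<phi> x" "kills \<phi> y" "kills \<phi> (x \<boxplus> y)" "kills \<phi> u" "\<not> kills \<phi> v"
    using \<open>flat x y u\<close> kills_frame_imp_kills[OF fr] unfolding flat_def by blast
  obtain \<psi> where \<psi>: "kills \<psi> x" "kills \<psi> y" "kills \<psi> (x \<boxplus> y)" "kills \<psi> v" "\<not> kills \<psi> u"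
    using \<open>flat x y v\<close> kills_frame_imp_kills[OF frame_swap(3)[OF fr]] unfolding flat_def by blast
  have scale: "\<exists>k. 3 dvd s + k * t" if "\<not> 3 dvd t" for s t :: int
  proof -
    have "3 dvd s + 0 * t \<or> 3 dvd s + 1 * t \<or> 3 dvd s + (- 1) * t"
      using that by presburger
    then show ?thesis by blast
  qed
  obtain k where k: "3 dvd pairing \<chi> v + k * pairing \<phi> v"
    using scale \<phi>(5) unfolding kills_def by blast
  obtain l where l: "3 dvd pairing \<chi> u + l * pairing \<psi> u"
    using scale \<psi>(5) unfolding kills_def by blast
  obtain \<xi> where \<xi>: "\<And>w. pairing \<xi> w = pairing \<chi> w + k * pairing \<phi> w"
    using pairing_combination[of \<chi> k \<phi>] by blast
  obtain \<omega> where "\<And>w. pairing \<omega> w = pairing \<xi> w + l * pairing \<psi> w"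
    using pairing_combination[of \<xi> l \<psi>] by blast
  then have \<omega>: "pairing \<omega> w = pairing \<chi> w + k * pairing \<phi> w + l * pairing \<psi> w" for w
    by (simp add: \<xi>)
  have z: "3 dvd k * pairing \<phi> w" if "kills \<phi> w" for w
    using that by (simp add: kills_def)
  have z': "3 dvd l * pairing \<psi> w" if "kills \<psi> w" for w
    using that by (simp add: kills_def)
  have "kills \<omega> x" "kills \<omega> y"
    using \<chi> z[OF \<phi>(1)] z[OF \<phi>(2)] z'[OF \<psi>(1)] z'[OF \<psi>(2)] unfolding kills_def \<omega> by auto
  moreover have "kills \<omega> u"
    using dvd_add[OF l z[OF \<phi>(4)]] unfolding kills_def \<omega> by (simp add: algebra_simps)
  moreover have "kills \<omega> v"
    using k z'[OF \<psi>(4)] unfolding kills_def \<omega> by (rule dvd_add)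
  ultimately have "kills \<omega> (x \<boxplus> y)"
    by (rule kills_frame_imp_kills[OF fr])
  then show ?thesis
    using dvd_add[OF z[OF \<phi>(3)] z'[OF \<psi>(3)]] unfolding kills_def \<omega>
    by (simp add: add.assoc dvd_add_left_iff)
qed

text \<open>Of the three planes through a line, with third points \<open>a\<close>, \<open>b\<close> and \<open>a \<boxplus> b\<close>, at most one fails
  to be flat. So \<open>f\<close> maps every binary line to three collinear points.\<close>

lemma kills_line:
  assumes fr: "frame x y a b" and \<chi>: "kills \<chi> x" "kills \<chi> y"
  shows "kills \<chi> (x \<boxplus> y)"
proof -
  let ?c = "a \<boxplus> b"
  have fr': "frame x y a ?c" "frame x y b ?c"
    using frame_shears(3)[OF fr] frame_shears(3)[OF frame_swap(3)[OF fr]]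
    by (simp_all add: bin_add_commute)
  note collinear = flat_planes_imp_collinear[OF _ _ _ \<chi>]
  show ?thesis
    using flat_or[OF fr] flat_or[OF fr'(1)] flat_or[OF fr'(2)]
      collinear[OF fr] collinear[OF fr'(1)] collinear[OF fr'(2)] by blast
qed

text \<open>Now \<open>f\<close> would represent the Fano plane over the field with three elements. The classical
  contradiction \<open>2 = 0\<close> appears as follows. The functional \<open>A\<close> annihilates the line through \<open>x \<boxplus> y\<close>
  and \<open>w\<close>, \<open>B\<close> the line through \<open>y \<boxplus> w\<close> and \<open>x\<close>, and \<open>D\<close> the line through \<open>x \<boxplus> y\<close>, \<open>y \<boxplus> w\<close>
  and \<open>x \<boxplus> w\<close>, with \<open>A\<close> and \<open>D\<close> scaled to agree at \<open>x\<close>, and \<open>A\<close> and \<open>B\<close> at \<open>y\<close>. Collinearity then gives \<open>D w = B w\<close> on the one hand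
  and \<open>D w = A w - B w = - B w\<close> on the other.\<close>

lemma no_binary_frame:
  assumes fr: "frame x y w b"
  shows False
proof -
  have l1: "frame x (x \<boxplus> y) w b"
    by (rule frame_shears(4)[OF fr])
  have yw: "frame y w x b"
    by (rule frame_swap(2)[OF frame_swap(1)[OF fr]])
  have l2: "frame y (y \<boxplus> w) x b"
    by (rule frame_shears(4)[OF yw])
  have l3: "frame x (x \<boxplus> w) y b" and l4: "frame w (x \<boxplus> w) y b"
    by (rule frame_shears(4,5)[OF frame_swap(2)[OF fr]])+
  have l5: "frame y ((x \<boxplus> y) \<boxplus> w) w b"
    by (rule frame_swap(1)[OF frame_swap(2)[OF frame_add[OF frame_swap(2)[OF frame_add[OF fr]]]]])
  have frA: "frame (x \<boxplus> y) w x b"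
    by (rule frame_swap(2)[OF frame_swap(1)[OF l1]])
  have frB: "frame (y \<boxplus> w) x y b"
    by (rule frame_swap(2)[OF frame_swap(1)[OF l2]])
  have frD: "frame (x \<boxplus> y) (y \<boxplus> w) x b"
    by (rule frame_swap(2)[OF frame_swap(1)[OF frame_shears(4)[OF
          frame_swap(1)[OF frame_swap(2)[OF l2]]]]])
  obtain A where A: "[pairing A (x \<boxplus> y) = 0] (mod 3)" "[pairing A w = 0] (mod 3)"
      "[pairing A x = 1] (mod 3)" "[pairing A b = 0] (mod 3)"
    by (rule functional_on_frame[OF frA])
  obtain B where B: "[pairing B (y \<boxplus> w) = 0] (mod 3)" "[pairing B x = 0] (mod 3)"
      "[pairing B y = pairing A y] (mod 3)" "[pairing B b = 0] (mod 3)"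
    by (rule functional_on_frame[OF frB])
  obtain D where D: "[pairing D (x \<boxplus> y) = 0] (mod 3)" "[pairing D (y \<boxplus> w) = 0] (mod 3)"
      "[pairing D x = 1] (mod 3)" "[pairing D b = 0] (mod 3)"
    by (rule functional_on_frame[OF frD])
  obtain DA where DA: "\<And>v. pairing DA v = pairing D v - pairing A v"
    using pairing_difference[of D A] by blast
  obtain DB where DB: "\<And>v. pairing DB v = pairing D v - pairing B v"
    using pairing_difference[of D B] by blast
  obtain AB where AB: "\<And>v. pairing AB v = pairing A v - pairing B v"
    using pairing_difference[of A B] by blast
  obtain E where E: "\<And>v. pairing E v = pairing D v - pairing AB v"
    using pairing_difference[of D AB] by blast
  have carr: "x \<in> {..<4} \<rightarrow>\<^sub>E {0..1}" "y \<in> {..<4} \<rightarrow>\<^sub>E {0..1}" "w \<in> {..<4} \<rightarrow>\<^sub>E {0..1}"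
    using fr unfolding frame_iff by blast+
  have sums: "x \<boxplus> (x \<boxplus> y) = y" "y \<boxplus> (y \<boxplus> w) = w" "x \<boxplus> (x \<boxplus> w) = w" "w \<boxplus> (x \<boxplus> w) = x"
      "y \<boxplus> ((x \<boxplus> y) \<boxplus> w) = x \<boxplus> w" "(y \<boxplus> w) \<boxplus> x = (x \<boxplus> y) \<boxplus> w"
      "(x \<boxplus> y) \<boxplus> (y \<boxplus> w) = x \<boxplus> w"
    using carr by (simp_all add: bin_add_ac bin_add_cancel bin_add_self_right bin_add_closed)
  have A0: "kills A (x \<boxplus> y)" "kills A w" and B0: "kills B (y \<boxplus> w)" "kills B x"
    and D0: "kills D (x \<boxplus> y)" "kills D (y \<boxplus> w)" and Dx: "\<not> kills D x"
    using A(1,2) B(1,2) D(1-3) by (auto simp: kills_def cong_0_iff cong_dvd_iff)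
  have "[pairing D x = pairing A x] (mod 3)"
    using D(3) A(3) by (metis cong_sym cong_trans)
  then have "kills DA x" "kills DA (x \<boxplus> y)"
    using A0 D0 by (auto simp: kills_def DA cong_iff_dvd_diff)
  then have "kills DA y" using kills_line[OF l1, of DA] by (simp add: sums)
  moreover have "kills AB y"
    using B(3) by (simp add: kills_def AB cong_iff_dvd_diff dvd_diff_commute)
  ultimately have "kills DB y" "kills DB (y \<boxplus> w)"
    using B0 D0 unfolding kills_def DA DB AB by presburger+
  then have DBw: "kills DB w" using kills_line[OF l2, of DB] by (simp add: sums)
  have "kills A ((x \<boxplus> y) \<boxplus> w)" "kills B ((x \<boxplus> y) \<boxplus> w)"
    using kills_line[OF frA A0] kills_line[OF frB B0] by (simp_all add: sums)
  then have "kills AB ((x \<boxplus> y) \<boxplus> w)"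
    by (simp add: kills_def AB)
  with \<open>kills AB y\<close> have ABxw: "kills AB (x \<boxplus> w)"
    using kills_line[OF l5, of AB] by (simp add: sums)
  have Dxw: "kills D (x \<boxplus> w)"
    using kills_line[OF frD D0] by (simp add: sums)
  have "kills E x" "kills E (x \<boxplus> w)"
    using \<open>kills DA x\<close> B0 ABxw Dxw unfolding kills_def DA E AB by presburger+
  then have "kills E w" using kills_line[OF l3, of E] by (simp add: sums)
  with A0 DBw have "kills D w" unfolding kills_def E AB DB by presburger
  with Dxw have "kills D x" using kills_line[OF l4, of D] by (simp add: sums)
  with Dx show False by blast
qed

end

lemma no_independent_map_to_ternary_4:
  assumes "\<And>\<sigma>. \<sigma> \<in> universal_complex 2 4 \<Longrightarrow> independent_mod 3 4 \<sigma> f"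
  shows False
proof -
  have two: "prime (2::nat)" by simp
  obtain \<tau> where \<tau>: "\<tau> \<in> universal_complex 2 4" "card \<tau> = 4"
    by (rule universal_complex_extend[OF two empty_in_universal_complex[OF two, of 4]])
  then obtain x y a b where "\<tau> = {x, y, a, b}" "distinct [x, y, a, b]"
    by (auto simp: card_Suc_eq numeral_eq_Suc)
  then have "frame x y a b" using \<tau>(1) by (simp add: frame_def)
  then show False using no_binary_frame[OF assms] by blast
qed

section \<open>The invariant\<close>

lemma buchstaber_eqI:
  assumes p: "prime p" and K: "\<And>\<sigma>. \<sigma> \<in> K \<Longrightarrow> finite \<sigma>"
    and ex: "\<And>\<sigma>. \<sigma> \<in> K \<Longrightarrow> f ` \<sigma> \<subseteq> carrier (coord_space p r) \<and> independent_mod p r \<sigma> f"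
    and least: "\<And>s g. s < r \<Longrightarrow> (\<And>\<sigma>. \<sigma> \<in> K \<Longrightarrow> independent_mod p s \<sigma> g) \<Longrightarrow> False"
  shows "buchstaber p K = int (card (vertices K)) - int r"
proof -
  let ?P = "\<lambda>r. \<exists>f. simplicial_map f K (universal_complex p r) \<and> nondegenerate_map f K"
  have iff: "?P s \<longleftrightarrow> (\<exists>g. \<forall>\<sigma>\<in>K. g ` \<sigma> \<subseteq> carrier (coord_space p s) \<and> independent_mod p s \<sigma> g)" for s
    using nondegenerate_simplicial_iff[OF p K, of K] by simp
  have "(LEAST r. ?P r) = r"
  proof (rule Least_equality)
    show "?P r" unfolding iff using ex by blast
    fix s assume "?P s"
    then show "r \<le> s" unfolding iff using least by (meson not_le)
  qed
  then show ?thesis by (simp add: buchstaber_def)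
qed

lemma target_rank_ge_4:
  assumes p: "prime p" and g: "\<And>\<sigma>. \<sigma> \<in> universal_complex 2 4 \<Longrightarrow> independent_mod p s \<sigma> g"
  shows "4 \<le> s"
proof -
  have two: "prime (2::nat)" by simp
  obtain \<tau> where \<tau>: "\<tau> \<in> universal_complex 2 4" "card \<tau> = 4"
    by (rule universal_complex_extend[OF two empty_in_universal_complex[OF two, of 4]])
  show ?thesis
    using independent_mod_card_le[OF g[OF \<tau>(1)] universal_complexD(3)[OF two \<tau>(1)] prime_gt_1_nat[OF p]]
      \<tau>(2) by simp
qed

theorem proposition4p7:
  fixes p :: nat
  assumes "prime p"
  shows "(p \<noteq> 3 \<longrightarrow> buchstaber p (universal_complex 2 4) = 11) \<and>
         buchstaber 3 (universal_complex 2 4) = 10"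
proof
  have two: "prime (2::nat)" and three: "prime (3::nat)" by simp_all
  have fin: "finite \<sigma>" if "\<sigma> \<in> universal_complex 2 4" for \<sigma>
    using universal_complexD(3)[OF two that] .
  show "p \<noteq> 3 \<longrightarrow> buchstaber p (universal_complex 2 4) = 11"
  proof
    assume "p \<noteq> 3"
    have "buchstaber p (universal_complex 2 4) = int (card (vertices (universal_complex 2 4))) - int 4"
    proof (rule buchstaber_eqI[OF assms fin])
      show "(\<lambda>v. v) ` \<sigma> \<subseteq> carrier (coord_space p 4) \<and> independent_mod p 4 \<sigma> (\<lambda>v. v)"
        if "\<sigma> \<in> universal_complex 2 4" for \<sigma>
        using subsetD[OF universal_complex_2_4_subset[OF assms \<open>p \<noteq> 3\<close>] that]
        unfolding universal_complex_iff[OF assms] by simp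
    next
      fix s g assume "s < 4" "\<And>\<sigma>. \<sigma> \<in> universal_complex 2 4 \<Longrightarrow> independent_mod p s \<sigma> g"
      then show False using target_rank_ge_4[OF assms, of s g] by simp
    qed
    then show "buchstaber p (universal_complex 2 4) = 11"
      by (simp add: card_vertices_universal_complex_2_4)
  qed
  let ?g = "\<lambda>v. \<lambda>j\<in>{..<5}. if j < 4 then v j else 1"
  have "buchstaber 3 (universal_complex 2 4) = int (card (vertices (universal_complex 2 4))) - int 5"
  proof (rule buchstaber_eqI[OF three fin])
    fix \<sigma> assume \<sigma>: "\<sigma> \<in> universal_complex 2 4"
    have "?g v \<in> {..<5} \<rightarrow>\<^sub>E {0..int 3 - 1}" if "v \<in> \<sigma>" for v
    proof (intro restrict_PiE_iff[THEN iffD2] ballI)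
      fix j assume "j \<in> {..<5::nat}"
      have "v \<in> {..<4} \<rightarrow>\<^sub>E {0..int 2 - 1}"
        using universal_complexD(1)[OF two \<sigma>] that by blast
      then have "v j \<in> {0..int 2 - 1}" if "j < 4" using that by (auto simp: PiE_iff)
      then show "(if j < 4 then v j else 1) \<in> {0..int 3 - 1}" by auto
    qed
    then show "?g ` \<sigma> \<subseteq> carrier (coord_space 3 5) \<and> independent_mod 3 5 \<sigma> ?g"
      using affine_lift_independent_mod_3[OF \<sigma>]
      unfolding coord_space_simps(1)[OF three] by (intro conjI image_subsetI)
  next
    fix s g assume "s < 5" and g: "\<And>\<sigma>. \<sigma> \<in> universal_complex 2 4 \<Longrightarrow> independent_mod 3 s \<sigma> g"
    then have "s = 4" using target_rank_ge_4[OF three g] by simp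
    with g no_independent_map_to_ternary_4 show False by blast
  qed
  then show "buchstaber 3 (universal_complex 2 4) = 10"
    by (simp add: card_vertices_universal_complex_2_4)
qed

end
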